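(* There is an algorithm which, given a permutation $B$ and an integer $k>0$, decides whether there exists a permutation $X$ with $X^k=B$ and, if so, computes it, in time polynomial in the size of $B$ (and the size of the encoding of $k$).
   Context: A permutation is a finite set with a bijection on it, viewed as a functional digraph (a disjoint union of cycles) up to isomorphism; its size is its number of states. The product of FDDSs is the direct product of digraphs (vertex set $V(A)\times V(B)$, arc $(u,u')\to(v,v')$ iff $u\to v$ and $u'\to v'$), and $X^k$ is the $k$-fold product. Permutations are given explicitly as graphs. *)

theory Defs
  imports "Graph_Theory.Graph_Theory" "HOL-Library.Log_Nat"
begin

definition perm_digraph :: "'a pair_pre_digraph \<Rightarrow> bool" where
  "perm_digraph G \<longleftrightarrow> finite (pverts G) \<and>
     (\<exists>f. bij_betw f (pverts G) (pverts G) \<and> parcs G = (\<lambda>u. (u, f u)) ` pverts G)"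

definition direct_product ::
    "'a pair_pre_digraph \<Rightarrow> 'b pair_pre_digraph \<Rightarrow> ('a \<times> 'b) pair_pre_digraph" where
  "direct_product G H =
     \<lparr> pverts = pverts G \<times> pverts H,
       parcs = {((u, u'), (v, v')) | u u' v v'. (u, v) \<in> parcs G \<and> (u', v') \<in> parcs H} \<rparr>"

definition relabel :: "('a \<Rightarrow> 'b) \<Rightarrow> 'a pair_pre_digraph \<Rightarrow> 'b pair_pre_digraph" where
  "relabel h G = \<lparr> pverts = h ` pverts G, parcs = map_prod h h ` parcs G \<rparr>"

text \<open>The iterated direct product.  The type of an iterated pair would depend on the exponent, so a
  tuple of states is stored as a list; the empty product is the one-state loop.\<close>

primrec digraph_power :: "'a pair_pre_digraph \<Rightarrow> nat \<Rightarrow> 'a list pair_pre_digraph" where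
  "digraph_power G 0 = \<lparr> pverts = {[]}, parcs = {([], [])} \<rparr>"
| "digraph_power G (Suc k) =
     relabel (\<lambda>(u, us). u # us) (direct_product G (digraph_power G k))"

definition isomorphic :: "'a pair_pre_digraph \<Rightarrow> 'b pair_pre_digraph \<Rightarrow> bool" where
  "isomorphic G H \<longleftrightarrow> digraph_iso (with_proj G) (with_proj H)"

text \<open>The explicit representation of a functional digraph: states \<open>0, \<dots>, n - 1\<close> together with the
  table of their successors.\<close>

definition table_digraph :: "nat \<Rightarrow> (nat \<Rightarrow> nat) \<Rightarrow> nat pair_pre_digraph" where
  "table_digraph n f = \<lparr> pverts = {..<n}, parcs = (\<lambda>u. (u, f u)) ` {..<n} \<rparr>"

text \<open>Up to isomorphism every permutation has such a representation.  In particular, nothing is lost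
  by letting permutations range over digraphs with states of type \<^typ>\<open>nat\<close>.\<close>

lemma perm_digraph_has_table:
  assumes "perm_digraph G"
  shows "\<exists>f. perm_digraph (table_digraph (card (pverts G)) f) \<and>
             isomorphic G (table_digraph (card (pverts G)) f)"
proof -
  let ?V = "pverts G" and ?N = "{..<card (pverts G)}"
  obtain g where fin: "finite ?V" and g: "bij_betw g ?V ?V"
    and arcs: "parcs G = (\<lambda>u. (u, g u)) ` ?V"
    using assms unfolding perm_digraph_def by blast
  obtain h where h: "bij_betw h ?V ?N"
    using ex_bij_betw_finite_nat[OF fin] by (auto simp: atLeast0LessThan)
  define h' where "h' = the_inv_into ?V h"
  define f where "f = h \<circ> g \<circ> h'"
  have h': "bij_betw h' ?N ?V"
    unfolding h'_def using h by (rule bij_betw_the_inv_into)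
  have h'h: "h' (h u) = u" if "u \<in> ?V" for u
    using h that by (simp add: h'_def bij_betw_def the_inv_into_f_f)
  have f: "bij_betw f ?N ?N"
    unfolding f_def using h' g h by (auto intro: bij_betw_trans simp: comp_assoc)
  have table: "perm_digraph (table_digraph (card ?V) f)"
    using f by (auto simp: perm_digraph_def table_digraph_def)
  let ?iso = "\<lparr> iso_verts = h, iso_arcs = map_prod h h, iso_head = snd, iso_tail = fst \<rparr>"
  have inj: "inj_on h ?V" and img: "h ` ?V = ?N" using h by (auto simp: bij_betw_def)
  have gV: "g u \<in> ?V" if "u \<in> ?V" for u using g that by (auto simp: bij_betw_def)
  have wf: "wf_digraph (with_proj G)"
    by unfold_locales (auto simp: arcs gV)
  have "map_prod h h ` parcs G = (\<lambda>u. (u, f u)) ` (h ` ?V)"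
    by (auto simp: arcs image_image f_def h'h)
  then have "with_proj (table_digraph (card ?V) f) = app_iso ?iso (with_proj G)"
    by (simp add: with_proj_def app_iso_def table_digraph_def img)
  moreover have "pre_digraph.digraph_isomorphism (with_proj G) ?iso"
    unfolding pre_digraph.digraph_isomorphism_def
    using wf inj gV by (auto simp: arcs inj_on_def)
  ultimately show ?thesis
    using table unfolding isomorphic_def digraph_iso_def by blast
qed

text \<open>A structured random access machine with the instruction set and the logarithmic cost criterion
  of Aho, Hopcroft and Ullman; polynomial time on it is polynomial time on Turing machines.
  The memory consists of arrays of natural numbers; array names are constants of the program, so a
  program uses only finitely many of them.  Every evaluation of an instruction is charged the binary
  length of all operands and addresses it involves.\<close>

type_synonym memory = "nat \<Rightarrow> nat \<Rightarrow> nat"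

datatype aexp =
    Const nat
  | Fetch nat aexp
  | Plus aexp aexp
  | Minus aexp aexp
  | Times aexp aexp
  | Div aexp aexp

datatype com =
    Skip
  | Store nat aexp aexp
  | Seq com com
  | Cond aexp com com
  | Loop aexp com

definition bits :: "nat \<Rightarrow> nat" where
  "bits v = max 1 (floorlog 2 v)"

primrec aval :: "aexp \<Rightarrow> memory \<Rightarrow> nat" where
  "aval (Const v) m = v"
| "aval (Fetch a e) m = m a (aval e m)"
| "aval (Plus e1 e2) m = aval e1 m + aval e2 m"
| "aval (Minus e1 e2) m = aval e1 m - aval e2 m"
| "aval (Times e1 e2) m = aval e1 m * aval e2 m"
| "aval (Div e1 e2) m = aval e1 m div aval e2 m"

primrec acost :: "aexp \<Rightarrow> memory \<Rightarrow> nat" where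
  "acost (Const v) m = bits v"
| "acost (Fetch a e) m = acost e m + bits (aval e m) + bits (m a (aval e m))"
| "acost (Plus e1 e2) m = acost e1 m + acost e2 m + bits (aval e1 m) + bits (aval e2 m)"
| "acost (Minus e1 e2) m = acost e1 m + acost e2 m + bits (aval e1 m) + bits (aval e2 m)"
| "acost (Times e1 e2) m = acost e1 m + acost e2 m + bits (aval e1 m) + bits (aval e2 m)"
| "acost (Div e1 e2) m = acost e1 m + acost e2 m + bits (aval e1 m) + bits (aval e2 m)"

text \<open>\<open>exec c m t m'\<close>: started in memory \<open>m\<close>, program \<open>c\<close> halts at cost \<open>t\<close> in memory \<open>m'\<close>.
  Tests succeed on nonzero values.\<close>

inductive exec :: "com \<Rightarrow> memory \<Rightarrow> nat \<Rightarrow> memory \<Rightarrow> bool" where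
  Skip: "exec Skip m 1 m"
| Store: "exec (Store a i e) m
            (acost i m + acost e m + bits (aval i m) + bits (aval e m))
            (m(a := (m a)(aval i m := aval e m)))"
| Seq: "exec c1 m t1 m1 \<Longrightarrow> exec c2 m1 t2 m2 \<Longrightarrow> exec (Seq c1 c2) m (t1 + t2) m2"
| CondTrue: "aval e m \<noteq> 0 \<Longrightarrow> exec c1 m t m' \<Longrightarrow>
    exec (Cond e c1 c2) m (acost e m + bits (aval e m) + t) m'"
| CondFalse: "aval e m = 0 \<Longrightarrow> exec c2 m t m' \<Longrightarrow>
    exec (Cond e c1 c2) m (acost e m + bits (aval e m) + t) m'"
| LoopFalse: "aval e m = 0 \<Longrightarrow> exec (Loop e c) m (acost e m + bits (aval e m)) m"
| LoopTrue: "aval e m \<noteq> 0 \<Longrightarrow> exec c m t1 m1 \<Longrightarrow> exec (Loop e c) m1 t2 m2 \<Longrightarrow>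
    exec (Loop e c) m (acost e m + bits (aval e m) + t1 + t2) m2"

lemma exec_deterministic:
  "exec c m t m1 \<Longrightarrow> exec c m u m2 \<Longrightarrow> u = t \<and> m2 = m1"
proof (induction arbitrary: u m2 rule: exec.induct)
  case (Skip m)
  then show ?case by cases simp
next
  case (Store a i e m)
  then show ?case by cases simp
next
  case (Seq c1 m t1 m1 c2 t2 m')
  from Seq.prems obtain u1 u2 w
    where w: "exec c1 m u1 w" "exec c2 w u2 m2" "u = u1 + u2"
    by cases simp
  from Seq.IH(1)[OF w(1)] Seq.IH(2)[of u2 m2] w show ?case by simp
next
  case (CondTrue e m c1 t m' c2)
  from CondTrue.prems obtain u' where u: "exec c1 m u' m2"
    "u = acost e m + bits (aval e m) + u'"
    using CondTrue.hyps(1) by cases simp_all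
  from CondTrue.IH[OF u(1)] u(2) show ?case by simp
next
  case (CondFalse e m c2 t m' c1)
  from CondFalse.prems obtain u' where u: "exec c2 m u' m2"
    "u = acost e m + bits (aval e m) + u'"
    using CondFalse.hyps(1) by cases simp_all
  from CondFalse.IH[OF u(1)] u(2) show ?case by simp
next
  case (LoopFalse e m c)
  from LoopFalse.prems LoopFalse.hyps show ?case by cases simp_all
next
  case (LoopTrue e m c t1 m1 t2 m')
  from LoopTrue.prems obtain u1 u2 w
    where w: "exec c m u1 w" "exec (Loop e c) w u2 m2"
      "u = acost e m + bits (aval e m) + u1 + u2"
    using LoopTrue.hyps(1) by cases simp_all
  from LoopTrue.IH(1)[OF w(1)] LoopTrue.IH(2)[of u2 m2] w show ?case by simp
qed

text \<open>Input: the number of states is in cell \<open>0\<close> of array \<open>0\<close>, the exponent in cell \<open>0\<close> of array \<open>1\<close>,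
  the successor table in array \<open>2\<close>; all other cells are \<open>0\<close>.\<close>

definition input_memory :: "nat \<Rightarrow> (nat \<Rightarrow> nat) \<Rightarrow> nat \<Rightarrow> memory" where
  "input_memory n f k = (\<lambda>a i.
     if a = 0 \<and> i = 0 then n
     else if a = 1 \<and> i = 0 then k
     else if a = 2 \<and> i < n then f i
     else 0)"

text \<open>Output: the answer (\<open>1\<close> for yes, \<open>0\<close> for no) is in cell \<open>0\<close> of array \<open>0\<close>; if it is yes, the
  digraph found has its number of states in cell \<open>0\<close> of array \<open>1\<close> and its successor table in
  array \<open>2\<close>.\<close>

definition output_answer :: "memory \<Rightarrow> nat" where
  "output_answer m = m 0 0"

definition output_digraph :: "memory \<Rightarrow> nat pair_pre_digraph" where
  "output_digraph m = table_digraph (m 1 0) (m 2)"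

end

theory Submission
  imports Defs
begin

text \<open>Let \<open>F d\<close> be the number of fixed points of the \<open>d\<close>-th iterate.  For permutations, the values \<open>F d\<close>
  determine the isomorphism type (remove a shortest cycle on both sides and induct; \<open>d\<close> up to the
  number of states suffices, with \<open>d = 0\<close> giving the size), and \<open>F\<close> is multiplicative, so
  \<open>X\<^sup>k\<close> is isomorphic to \<open>B\<close> iff \<open>F X d ^ k = F B d\<close> for all \<open>d \<le> n\<close>.  Hence \<open>X\<close> can be built greedily:
  for \<open>l = 1, \<dots>, n\<close>, add cycles of length \<open>l\<close> as long as \<open>F X l ^ k < F B l\<close>, and finally verify all
  equations.  Since \<open>F B d \<le> n\<close>, an exponent above \<open>n + 1\<close> may be replaced by \<open>n + 1\<close>, which keeps the bit
  length of all powers polynomial in \<open>n\<close>.\<close>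

subsection \<open>Counting fixed points of iterates\<close>

text \<open>The greedy choice is safe because \<open>c ^ k\<close> is strictly increasing in
  \<open>c\<close> for \<open>k > 0\<close>. If a root exists and the partial \<open>X\<close> is
  contained in it and has all its cycles shorter than \<open>l\<close>, then
  \<open>F X l ^ k < F B l\<close> holds exactly when the root has a further cycle of length
  \<open>l\<close>. So the counts force every step. Without a root the same comparisons may
  overshoot, and only the final check notices. The construction must therefore be bounded without
  assuming a root: each length gets \<open>n\<close> rounds, enough because a root has at most
  \<open>n\<close> states, and this limits \<open>X\<close> to \<open>n ^ 3\<close> states in every
  case. Two costs need care. The exponent is written in binary, so \<open>k\<close> multiplications
  are not affordable before it is capped; and since operations are charged by bit length, every
  number that occurs, even on the way to a negative answer, needs an explicit bound.\<close>

definition fix_count :: "'a set \<Rightarrow> ('a \<Rightarrow> 'a) \<Rightarrow> nat \<Rightarrow> nat" where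
  "fix_count V f d = card {u \<in> V. (f ^^ d) u = u}"

lemma fix_count_0 [simp]: "fix_count V f 0 = card V"
  by (simp add: fix_count_def)

lemma fix_count_le_card: "finite V \<Longrightarrow> fix_count V f d \<le> card V"
  unfolding fix_count_def by (rule card_mono) auto

lemma fix_count_mono: "finite V \<Longrightarrow> W \<subseteq> V \<Longrightarrow> fix_count W f d \<le> fix_count V f d"
  unfolding fix_count_def by (rule card_mono) auto

lemma fix_count_pos_iff:
  "finite V \<Longrightarrow> 0 < fix_count V f d \<longleftrightarrow> (\<exists>u\<in>V. (f ^^ d) u = u)"
  unfolding fix_count_def by (auto simp: card_gt_0_iff)

lemma fix_count_Un_disjoint:
  assumes "finite A" "finite B" "A \<inter> B = {}"
  shows "fix_count (A \<union> B) f d = fix_count A f d + fix_count B f d"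
proof -
  have "{u \<in> A \<union> B. (f ^^ d) u = u} = {u \<in> A. (f ^^ d) u = u} \<union> {u \<in> B. (f ^^ d) u = u}"
    by auto
  then show ?thesis
    unfolding fix_count_def using assms by (auto intro!: card_Un_disjoint)
qed

lemma funpow_in:
  assumes "f ` V \<subseteq> V" "u \<in> V"
  shows "(f ^^ d) u \<in> V"
  using assms by (induction d) auto

lemma funpow_intertwine:
  assumes "f ` V \<subseteq> V" "\<And>u. u \<in> V \<Longrightarrow> h (f u) = g (h u)" "u \<in> V"
  shows "h ((f ^^ d) u) = (g ^^ d) (h u)"
  using assms by (induction d) (auto simp: funpow_in)

lemma fix_count_conjugate:
  assumes f: "f ` V \<subseteq> V" and h: "bij_betw h V W"
    and hf: "\<And>u. u \<in> V \<Longrightarrow> h (f u) = g (h u)"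
  shows "fix_count V f d = fix_count W g d"
proof -
  have inj: "inj_on h V" and img: "h ` V = W" using h by (auto simp: bij_betw_def)
  have iff: "(g ^^ d) (h u) = h u \<longleftrightarrow> (f ^^ d) u = u" if "u \<in> V" for u
    using funpow_intertwine[of f V h g u d, OF f hf that] funpow_in[OF f that, of d] that
      inj_on_eq_iff[OF inj, of "(f ^^ d) u" u] by simp
  have "bij_betw h {u \<in> V. (f ^^ d) u = u} {u \<in> W. (g ^^ d) u = u}"
    unfolding bij_betw_def
  proof
    show "inj_on h {u \<in> V. (f ^^ d) u = u}" using inj by (auto simp: inj_on_def)
    show "h ` {u \<in> V. (f ^^ d) u = u} = {u \<in> W. (g ^^ d) u = u}" using iff img by auto
  qed
  then show ?thesis unfolding fix_count_def by (rule bij_betw_same_card)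
qed

text \<open>Closure under \<open>g\<close> keeps the iterates inside \<open>V\<close>, where the two
  maps agree. This lets a table in memory replace the intended function, from which it may differ
  outside the states.\<close>

lemma fix_count_cong:
  assumes "g ` V \<subseteq> V" "\<And>u. u \<in> V \<Longrightarrow> f u = g u"
  shows "fix_count V f d = fix_count V g d"
  using assms by (intro fix_count_conjugate[where h = id]) auto

section \<open>Cycles, and the classification of permutations by their counts\<close>

definition cycle_enum :: "(nat \<Rightarrow> 'a) \<Rightarrow> nat \<Rightarrow> 'a set \<Rightarrow> ('a \<Rightarrow> 'a) \<Rightarrow> bool" where
  "cycle_enum c l A f \<longleftrightarrow> 0 < l \<and> bij_betw c {..<l} A \<and> (\<forall>i<l. f (c i) = c (Suc i mod l))"

lemma rotation_funpow: "i < l \<Longrightarrow> ((\<lambda>i. Suc i mod l) ^^ d) i = (i + d) mod l"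
  by (induction d) (auto simp: mod_Suc_eq)

text \<open>Along the enumeration, \<open>f ^^ d\<close> becomes \<open>i + d\<close> modulo
  \<open>l\<close>, which fixes either every index or none.\<close>

lemma fix_count_cycle:
  assumes "cycle_enum c l A f"
  shows "fix_count A f d = (if l dvd d then l else 0)"
proof -
  let ?r = "\<lambda>i. Suc i mod l"
  have l: "0 < l" using assms by (simp add: cycle_enum_def)
  have "fix_count {..<l} ?r d = fix_count A f d"
    using assms by (intro fix_count_conjugate[of _ _ c]) (auto simp: cycle_enum_def)
  moreover have "(i + d) mod l = i \<longleftrightarrow> l dvd d" if "i < l" for i
    using mod_eq_dvd_iff_nat[of i "i + d" l] that by auto
  then have "{i \<in> {..<l}. (?r ^^ d) i = i} = (if l dvd d then {..<l} else {})"
    by (auto simp: rotation_funpow)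
  then have "fix_count {..<l} ?r d = (if l dvd d then l else 0)"
    by (simp add: fix_count_def)
  ultimately show ?thesis by simp
qed

lemma cycle_enum_bij:
  assumes "cycle_enum c l A f"
  shows "bij_betw f A A"
proof -
  have l: "0 < l" and c: "bij_betw c {..<l} A" and fc: "\<And>i. i < l \<Longrightarrow> f (c i) = c (Suc i mod l)"
    using assms by (auto simp: cycle_enum_def)
  have fin: "finite A" using c bij_betw_finite by blast
  have "f ` A = A"
  proof
    show "f ` A \<subseteq> A" using c l fc by (auto simp: bij_betw_def)
    show "A \<subseteq> f ` A"
    proof
      fix a assume "a \<in> A"
      then obtain i where i: "i < l" "a = c i" using c by (auto simp: bij_betw_def)
      \<comment> \<open>The predecessor of \<open>i\<close> modulo \<open>l\<close>; adding
        \<open>l - 1\<close> avoids truncated subtraction at \<open>i = 0\<close>.\<close>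
      let ?j = "(i + (l - 1)) mod l"
      have "Suc ?j mod l = i" using i l by (simp add: mod_Suc_eq)
      then have "f (c ?j) = a" using fc[of ?j] l i by simp
      moreover have "c ?j \<in> A" using c l by (auto simp: bij_betw_def)
      ultimately show "a \<in> f ` A" by blast
    qed
  qed
  then show ?thesis using fin by (simp add: bij_betw_def eq_card_imp_inj_on)
qed

text \<open>A point fixed by \<open>f ^^ l\<close> has an orbit of exact length \<open>l\<close>,
  since a shorter period would contradict \<open>least\<close>. Both the classification and the
  greedy step remove such a cycle.\<close>

lemma ex_shortest_cycle:
  assumes fin: "finite V" and f: "bij_betw f V V" and l: "0 < l"
    and pos: "0 < fix_count V f l" and least: "\<And>d. 0 < d \<Longrightarrow> d < l \<Longrightarrow> fix_count V f d = 0"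
  obtains A c where "A \<subseteq> V" "cycle_enum c l A f" "bij_betw f (V - A) (V - A)"
    "\<And>d. fix_count V f d = (if l dvd d then l else 0) + fix_count (V - A) f d"
proof -
  have fV: "f ` V \<subseteq> V" using f by (auto simp: bij_betw_def)
  obtain u where u: "u \<in> V" "(f ^^ l) u = u" using pos fin by (auto simp: fix_count_pos_iff)
  have ne: "(f ^^ d) u \<noteq> u" if "0 < d" "d < l" for d
    using least[OF that] u fix_count_pos_iff[OF fin, of f d] by auto
  let ?c = "\<lambda>i. (f ^^ i) u"
  let ?A = "?c ` {..<l}"
  have inj: "inj_on ?c {..<l}"
    using inj_on_funpow_least[OF u(2)] ne by (simp add: atLeast0LessThan)
  have A: "?A \<subseteq> V" using funpow_in[OF fV u(1)] by auto
  have cyc: "cycle_enum ?c l ?A f"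
    unfolding cycle_enum_def
  proof (intro conjI allI impI)
    show "bij_betw ?c {..<l} ?A" using inj by (simp add: bij_betw_def)
    show "f (?c i) = ?c (Suc i mod l)" for i
      using funpow_mod_eq[OF u(2), of "Suc i"] by simp
  qed (rule l)
  have "bij_betw f (V - ?A) (V - ?A)"
    using f cycle_enum_bij[OF cyc] A
    by (metis (no_types, lifting) bij_betw_DiffI)
  moreover have "fix_count V f d = (if l dvd d then l else 0) + fix_count (V - ?A) f d" for d
    using fix_count_Un_disjoint[of ?A "V - ?A" f d] fin A fix_count_cycle[OF cyc, of d]
    by (simp add: Un_absorb1)
  ultimately show thesis using that A cyc by blast
qed

text \<open>Among \<open>card V + 1\<close> iterates of a point two coincide, and injectivity
  cancels the earlier one. So a nonempty permutation shows itself in a count of positive index at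
  most \<open>card V\<close>.\<close>

lemma ex_period_le_card:
  assumes fin: "finite V" and f: "bij_betw f V V" and ne: "V \<noteq> {}"
  shows "\<exists>l. 0 < l \<and> l \<le> card V \<and> 0 < fix_count V f l"
proof -
  obtain u where u: "u \<in> V" using ne by blast
  have fV: "f ` V \<subseteq> V" using f by (auto simp: bij_betw_def)
  have "\<not> inj_on (\<lambda>i. (f ^^ i) u) {..card V}"
  proof
    assume "inj_on (\<lambda>i. (f ^^ i) u) {..card V}"
    then have "card {..card V} \<le> card V"
      using fin funpow_in[OF fV u] by (intro card_inj_on_le) auto
    then show False by simp
  qed
  then obtain i j where ij: "i < j" "j \<le> card V" "(f ^^ i) u = (f ^^ j) u"
    unfolding inj_on_def by (metis atMost_iff linorder_neqE_nat)
  have "inj_on (f ^^ i) V"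
    using bij_betw_funpow[OF f, of i] by (simp add: bij_betw_def)
  moreover have "(f ^^ i) ((f ^^ (j - i)) u) = (f ^^ i) u"
    using ij by (metis funpow_add comp_apply le_add_diff_inverse less_imp_le)
  ultimately have "(f ^^ (j - i)) u = u"
    using funpow_in[OF fV u] u by (auto dest: inj_onD)
  then show ?thesis using ij u fin
    by (intro exI[of _ "j - i"]) (auto simp: fix_count_pos_iff)
qed

text \<open>The least period \<open>l\<close> is at most \<open>card V\<close>, so the hypothesis
  reaches it and \<open>l\<close> is the shortest cycle length on both sides. Removing a cycle of
  that length lowers equal counts equally, so they still agree up to the smaller bound
  \<open>card (V - A)\<close>.\<close>

lemma fix_count_eq_imp_conjugate:
  assumes "finite V" "finite W" "bij_betw f V V" "bij_betw g W W"
    and "\<And>d. d \<le> card V \<Longrightarrow> fix_count V f d = fix_count W g d"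
  shows "\<exists>h. bij_betw h V W \<and> (\<forall>u\<in>V. h (f u) = g (h u))"
  using assms
proof (induction "card V" arbitrary: V W rule: less_induct)
  case less
  have card_eq: "card V = card W" using less.prems(5)[of 0] by simp
  show ?case
  proof (cases "V = {}")
    case True
    then show ?thesis using card_eq less.prems by (auto simp: bij_betw_def)
  next
    case False
    define l where "l = (LEAST l. 0 < l \<and> 0 < fix_count V f l)"
    obtain l0 where l0: "0 < l0" "l0 \<le> card V" "0 < fix_count V f l0"
      using ex_period_le_card[OF less.prems(1,3) False] by blast
    have l: "0 < l" "0 < fix_count V f l" and "l \<le> l0"
      using LeastI[of "\<lambda>l. 0 < l \<and> 0 < fix_count V f l" l0]
        Least_le[of "\<lambda>l. 0 < l \<and> 0 < fix_count V f l" l0] l0 unfolding l_def by auto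
    then have l_le: "l \<le> card V" using l0 by simp
    have min: "fix_count V f d = 0" if "0 < d" "d < l" for d
      using that not_less_Least[of d "\<lambda>l. 0 < l \<and> 0 < fix_count V f l"] unfolding l_def by auto
    obtain A c where A: "A \<subseteq> V" "cycle_enum c l A f" "bij_betw f (V - A) (V - A)"
      and cV: "\<And>d. fix_count V f d = (if l dvd d then l else 0) + fix_count (V - A) f d"
      using ex_shortest_cycle[OF less.prems(1,3) l min] by metis
    have "0 < fix_count W g l" using l l_le less.prems(5) by simp
    moreover have "fix_count W g d = 0" if "0 < d" "d < l" for d
      using min[OF that] less.prems(5)[of d] that l_le by simp
    ultimately obtain A' c' where A': "A' \<subseteq> W" "cycle_enum c' l A' g" "bij_betw g (W - A') (W - A')"
      and cW: "\<And>d. fix_count W g d = (if l dvd d then l else 0) + fix_count (W - A') g d"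
      using ex_shortest_cycle[OF less.prems(2,4) l(1)] by metis
    have "card V = l + card (V - A)" using cV[of 0] by simp
    then have card_less: "card (V - A) < card V" using l by simp
    have "\<exists>h. bij_betw h (V - A) (W - A') \<and> (\<forall>u\<in>V - A. h (f u) = g (h u))"
    proof (rule less.hyps[OF card_less])
      show "fix_count (V - A) f d = fix_count (W - A') g d" if "d \<le> card (V - A)" for d
        using cV[of d] cW[of d] less.prems(5)[of d] that card_less by simp
    qed (use less.prems A A' in auto)
    then obtain h where h: "bij_betw h (V - A) (W - A')" "\<And>u. u \<in> V - A \<Longrightarrow> h (f u) = g (h u)"
      by blast
    \<comment> \<open>Matches the two removed cycles index by index; both maps act on the indices as
      \<open>Suc i mod l\<close>.\<close>
    define e where "e = (\<lambda>u. c' (the_inv_into {..<l} c u))"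
    have c: "bij_betw c {..<l} A" "bij_betw c' {..<l} A'"
      using A(2) A'(2) by (auto simp: cycle_enum_def)
    have ec: "e (c i) = c' i" if "i < l" for i
      using c(1) that by (simp add: e_def bij_betw_def the_inv_into_f_f)
    have "bij_betw (c' \<circ> the_inv_into {..<l} c) A A'"
      using bij_betw_trans[OF bij_betw_the_inv_into[OF c(1)] c(2)] .
    then have e: "bij_betw e A A'" by (simp add: e_def comp_def)
    have eg: "e (f u) = g (e u)" if "u \<in> A" for u
    proof -
      obtain i where i: "i < l" "u = c i" using c(1) \<open>u \<in> A\<close> by (auto simp: bij_betw_def)
      then show ?thesis using A(2) A'(2) ec by (simp add: cycle_enum_def)
    qed
    define H where "H = (\<lambda>u. if u \<in> A then e u else h u)"
    \<comment> \<open>Orbits neither enter nor leave \<open>A\<close>, so \<open>H\<close> uses the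
      same piece at \<open>u\<close> and at \<open>f u\<close>.\<close>
    have fA: "f u \<in> A \<longleftrightarrow> u \<in> A" if "u \<in> V" for u
      using A(3) cycle_enum_bij[OF A(2)] that by (auto simp: bij_betw_def)
    have "bij_betw H (A \<union> (V - A)) (A' \<union> (W - A'))"
    proof (rule bij_betw_combine)
      show "bij_betw H A A'" using e by (rule bij_betw_cong[THEN iffD1, rotated]) (simp add: H_def)
      show "bij_betw H (V - A) (W - A')"
        using h(1) by (rule bij_betw_cong[THEN iffD1, rotated]) (simp add: H_def)
    qed auto
    then have "bij_betw H V W" using A A' by (simp add: Un_absorb1)
    moreover have "H (f u) = g (H u)" if "u \<in> V" for u
      using that fA eg h(2) by (auto simp: H_def)
    ultimately show ?thesis by blast
  qed
qed

subsection \<open>Digraphs of functions\<close>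

definition fun_digraph :: "'a set \<Rightarrow> ('a \<Rightarrow> 'a) \<Rightarrow> 'a pair_pre_digraph" where
  "fun_digraph V f = \<lparr> pverts = V, parcs = (\<lambda>u. (u, f u)) ` V \<rparr>"

lemma perm_digraph_iff:
  "perm_digraph G \<longleftrightarrow> (\<exists>V f. finite V \<and> bij_betw f V V \<and> G = fun_digraph V f)"
proof
  assume "perm_digraph G"
  then obtain f where "finite (pverts G)" "bij_betw f (pverts G) (pverts G)"
    "parcs G = (\<lambda>u. (u, f u)) ` pverts G"
    by (auto simp: perm_digraph_def)
  then show "\<exists>V f. finite V \<and> bij_betw f V V \<and> G = fun_digraph V f"
    by (intro exI[of _ "pverts G"] exI[of _ f]) (simp add: fun_digraph_def)
qed (auto simp: perm_digraph_def fun_digraph_def)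

text \<open>\<open>perm_digraph\<close> asks for some bijection with the given arcs; arcs of the
  form \<open>(u, f u)\<close> determine the function on \<open>V\<close>, so that bijection agrees
  with \<open>f\<close> there.\<close>

lemma perm_fun_digraph_iff: "perm_digraph (fun_digraph V f) \<longleftrightarrow> finite V \<and> bij_betw f V V"
proof
  assume "perm_digraph (fun_digraph V f)"
  then obtain g where "finite V" and g: "bij_betw g V V"
    and eq: "(\<lambda>u. (u, f u)) ` V = (\<lambda>u. (u, g u)) ` V"
    by (auto simp: perm_digraph_def fun_digraph_def)
  have "f u = g u" if "u \<in> V" for u
  proof -
    have "(u, f u) \<in> (\<lambda>u. (u, g u)) ` V" using eq that by blast
    then show ?thesis by auto
  qed
  then show "finite V \<and> bij_betw f V V" using \<open>finite V\<close> g bij_betw_cong[of V f g V] by auto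
qed (auto simp: perm_digraph_def fun_digraph_def)

lemma table_digraph_eq: "table_digraph n f = fun_digraph {..<n} f"
  by (simp add: table_digraph_def fun_digraph_def)

text \<open>An isomorphism carries a separate arc map, but each state has a single outgoing arc: the
  image of \<open>(u, f u)\<close> starts at \<open>h u\<close> and hence ends at
  \<open>g (h u)\<close>. The vertex map therefore suffices.\<close>

lemma isomorphic_fun_digraph_iff:
  assumes f: "f ` V \<subseteq> V" and g: "g ` W \<subseteq> W"
  shows "isomorphic (fun_digraph V f) (fun_digraph W g) \<longleftrightarrow>
    (\<exists>h. bij_betw h V W \<and> (\<forall>u\<in>V. h (f u) = g (h u)))"
proof
  assume "isomorphic (fun_digraph V f) (fun_digraph W g)"
  then obtain hom where
    hom: "pre_digraph.digraph_isomorphism (with_proj (fun_digraph V f)) hom"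
    and eq: "with_proj (fun_digraph W g) = app_iso hom (with_proj (fun_digraph V f))"
    unfolding isomorphic_def digraph_iso_def by blast
  let ?h = "iso_verts hom"
  have arcs: "(\<lambda>u. (u, g u)) ` W = iso_arcs hom ` (\<lambda>u. (u, f u)) ` V"
    and verts: "W = ?h ` V" and tail: "iso_tail hom = fst" and head: "iso_head hom = snd"
    using eq by (auto simp: with_proj_def app_iso_def fun_digraph_def)
  have inj: "inj_on ?h V"
    and ends: "\<And>u. u \<in> V \<Longrightarrow> ?h u = fst (iso_arcs hom (u, f u)) \<and> ?h (f u) = snd (iso_arcs hom (u, f u))"
    using hom tail head
    by (auto simp: pre_digraph.digraph_isomorphism_def with_proj_def fun_digraph_def)
  have "?h (f u) = g (?h u)" if "u \<in> V" for u
  proof -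
    have "iso_arcs hom (u, f u) \<in> (\<lambda>u. (u, g u)) ` W" using that arcs by blast
    then show ?thesis using ends[OF that] by auto
  qed
  then show "\<exists>h. bij_betw h V W \<and> (\<forall>u\<in>V. h (f u) = g (h u))"
    using inj verts by (auto simp: bij_betw_def)
next
  assume "\<exists>h. bij_betw h V W \<and> (\<forall>u\<in>V. h (f u) = g (h u))"
  then obtain h where inj: "inj_on h V" and img: "h ` V = W" and hf: "\<And>u. u \<in> V \<Longrightarrow> h (f u) = g (h u)"
    by (auto simp: bij_betw_def)
  let ?iso = "\<lparr> iso_verts = h, iso_arcs = map_prod h h, iso_head = snd, iso_tail = fst \<rparr>"
  have wf: "wf_digraph (with_proj (fun_digraph V f))"
    using f by unfold_locales (auto simp: fun_digraph_def)
  have "map_prod h h ` (\<lambda>u. (u, f u)) ` V = (\<lambda>u. (u, g u)) ` W"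
    unfolding img[symmetric] by (auto simp: image_image hf)
  then have "with_proj (fun_digraph W g) = app_iso ?iso (with_proj (fun_digraph V f))"
    by (simp add: with_proj_def app_iso_def fun_digraph_def img)
  moreover have "pre_digraph.digraph_isomorphism (with_proj (fun_digraph V f)) ?iso"
    unfolding pre_digraph.digraph_isomorphism_def
    using wf inj f by (auto simp: fun_digraph_def inj_on_def)
  ultimately show "isomorphic (fun_digraph V f) (fun_digraph W g)"
    unfolding isomorphic_def digraph_iso_def by blast
qed

lemma isomorphic_perm_iff_fix_count:
  assumes "finite V" "bij_betw f V V" "finite W" "bij_betw g W W"
  shows "isomorphic (fun_digraph V f) (fun_digraph W g) \<longleftrightarrow>
    (\<forall>d\<le>card W. fix_count V f d = fix_count W g d)" (is "?I \<longleftrightarrow> ?F")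
proof -
  have f: "f ` V \<subseteq> V" and g: "g ` W \<subseteq> W" using assms by (auto simp: bij_betw_def)
  show ?thesis
  proof
    show ?F if ?I
      using that fix_count_conjugate[OF f] unfolding isomorphic_fun_digraph_iff[OF f g] by metis
    show ?I if F: ?F
    proof -
      \<comment> \<open>The equation for \<open>d = 0\<close> compares the sizes, so the bound
        \<open>card W\<close> may stand for \<open>card V\<close>.\<close>
      have "card V = card W" using F by (metis bot_nat_0.extremum fix_count_0)
      then show ?I
        using fix_count_eq_imp_conjugate[OF assms(1,3,2,4)] F
        unfolding isomorphic_fun_digraph_iff[OF f g] by simp
    qed
  qed
qed

section \<open>Powers of permutations and their counts\<close>

lemma digraph_power_fun_digraph:
  "digraph_power (fun_digraph V f) k = fun_digraph {us. set us \<subseteq> V \<and> length us = k} (map f)"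
proof (induction k)
  case 0
  have "{us. set us \<subseteq> V \<and> length us = 0} = {[]}" by auto
  then show ?case by (simp add: fun_digraph_def)
next
  case (Suc k)
  let ?L = "{us. set us \<subseteq> V \<and> length us = k}"
  have L: "{us. set us \<subseteq> V \<and> length us = Suc k} = (\<lambda>(u, us). u # us) ` (V \<times> ?L)"
    by (auto simp: length_Suc_conv image_iff)
  have arcs: "parcs (direct_product (fun_digraph V f) (fun_digraph ?L (map f)))
      = (\<lambda>(u, us). ((u, us), (f u, map f us))) ` (V \<times> ?L)"
    by (auto simp: direct_product_def fun_digraph_def image_iff)
  show ?case
    unfolding digraph_power.simps Suc relabel_def arcs unfolding fun_digraph_def L
    by (auto simp: direct_product_def image_image case_prod_unfold)
qed

text \<open>\<open>map f\<close> iterates entrywise, so the fixed lists are the lists of length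
  \<open>k\<close> over the fixed points of \<open>f ^^ d\<close>.\<close>

lemma fix_count_power:
  assumes "finite V"
  shows "fix_count {us. set us \<subseteq> V \<and> length us = k} (map f) d = fix_count V f d ^ k"
proof -
  have pow: "(map f ^^ d) us = map (f ^^ d) us" for us by (induction d) auto
  have "map (f ^^ d) us = us \<longleftrightarrow> (\<forall>u\<in>set us. (f ^^ d) u = u)" for us by (induction us) auto
  then have "{us \<in> {us. set us \<subseteq> V \<and> length us = k}. (map f ^^ d) us = us}
    = {us. set us \<subseteq> {u \<in> V. (f ^^ d) u = u} \<and> length us = k}"
    by (auto simp: pow)
  then show ?thesis using assms by (simp add: fix_count_def card_lists_length_eq)
qed

lemma bij_betw_map_lists:
  assumes "finite V" "bij_betw f V V"
  shows "bij_betw (map f) {us. set us \<subseteq> V \<and> length us = k} {us. set us \<subseteq> V \<and> length us = k}"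
proof -
  let ?L = "{us. set us \<subseteq> V \<and> length us = k}"
  have "inj_on (map f) ?L"
  proof (rule inj_onI)
    fix us vs assume "us \<in> ?L" "vs \<in> ?L" "map f us = map f vs"
    moreover from this have "inj_on f (set us \<union> set vs)"
      using assms(2) by (auto simp: bij_betw_def intro: inj_on_subset)
    ultimately show "us = vs" by (blast intro: map_inj_on)
  qed
  moreover have "map f ` ?L \<subseteq> ?L" using bij_betwE[OF assms(2)] by (auto simp: subset_iff)
  moreover have "finite ?L" using assms(1) by (rule finite_lists_length_eq)
  ultimately show ?thesis by (simp add: bij_betw_def endo_inj_surj)
qed

lemma power_isomorphic_iff_fix_count:
  assumes "finite V" "bij_betw f V V" "finite W" "bij_betw g W W"
  shows "isomorphic (digraph_power (fun_digraph V f) k) (fun_digraph W g) \<longleftrightarrow>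
    (\<forall>d\<le>card W. fix_count V f d ^ k = fix_count W g d)"
  unfolding digraph_power_fun_digraph
  using isomorphic_perm_iff_fix_count[OF finite_lists_length_eq[OF assms(1)]
      bij_betw_map_lists[OF assms(1,2)] assms(3,4)]
  by (simp add: fix_count_power[OF assms(1)])

text \<open>Positive exponents leave 0 and 1 unchanged, and a base of at least 2 exceeds
  \<open>n\<close> at exponent \<open>Suc n\<close>, so neither equation holds when the cap takes
  effect. The cap \<open>Suc n\<close> stays positive for \<open>n = 0\<close>.\<close>

lemma power_eq_iff_capped:
  assumes "0 < k" "b \<le> n"
  shows "c ^ k = b \<longleftrightarrow> c ^ min k (Suc n) = b"
proof (cases "c \<le> 1")
  case True
  then have "c = 0 \<or> c = 1" by auto
  then show ?thesis using assms by (auto simp: zero_power)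
next
  case False
  show ?thesis
  proof (cases "k \<le> Suc n")
    case False
    have "n < 2 ^ Suc n" using less_exp[of "Suc n"] by simp
    also have "\<dots> \<le> c ^ Suc n" using \<open>\<not> c \<le> 1\<close> by (intro power_mono) auto
    finally have "n < c ^ Suc n" .
    moreover have "c ^ Suc n \<le> c ^ k" using False \<open>\<not> c \<le> 1\<close> by (intro power_increasing) auto
    ultimately show ?thesis using assms False by auto
  qed (simp add: min_absorb1)
qed

subsection \<open>Cost bounds for programs\<close>

text \<open>If all cells stay below \<open>2 ^ B\<close>, an expression \<open>e\<close> has at most \<open>B * expr_size e\<close> bits and costs
  at most \<open>B * expr_weight e\<close>.  In \<open>runs B c m T Q\<close> the cost is therefore measured in units of \<open>B\<close>, which
  reduces the logarithmic cost criterion to counting instructions.\<close>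

definition bounded :: "nat \<Rightarrow> memory \<Rightarrow> bool" where
  "bounded B m \<longleftrightarrow> 0 < B \<and> (\<forall>a i. m a i < 2 ^ B)"

text \<open>\<open>Fetch\<close> has size 1 whatever its address, because every cell is below
  \<open>2 ^ B\<close>. Constants are counted by value, which is crude but independent of the input,
  since they are part of the program.\<close>

primrec expr_size :: "aexp \<Rightarrow> nat" where
  "expr_size (Const v) = Suc v"
| "expr_size (Fetch a e) = 1"
| "expr_size (Plus e1 e2) = expr_size e1 + expr_size e2"
| "expr_size (Minus e1 e2) = expr_size e1 + expr_size e2"
| "expr_size (Times e1 e2) = expr_size e1 + expr_size e2"
| "expr_size (Div e1 e2) = expr_size e1 + expr_size e2"

primrec expr_weight :: "aexp \<Rightarrow> nat" where
  "expr_weight (Const v) = Suc v"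
| "expr_weight (Fetch a e) = expr_weight e + expr_size e + 1"
| "expr_weight (Plus e1 e2) = expr_weight e1 + expr_weight e2 + expr_size e1 + expr_size e2"
| "expr_weight (Minus e1 e2) = expr_weight e1 + expr_weight e2 + expr_size e1 + expr_size e2"
| "expr_weight (Times e1 e2) = expr_weight e1 + expr_weight e2 + expr_size e1 + expr_size e2"
| "expr_weight (Div e1 e2) = expr_weight e1 + expr_weight e2 + expr_size e1 + expr_size e2"

lemma expr_size_pos: "0 < expr_size e"
  by (induction e) auto

text \<open>Two numbers that are at least 2 have a sum no larger than their product; positive
  exponents make both powers such numbers.\<close>

lemma add_less_power2:
  fixes a b x y :: nat
  assumes "a < 2 ^ x" "b < 2 ^ y" "0 < x" "0 < y"
  shows "a + b < 2 ^ (x + y)"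
proof -
  have "2 \<le> (2::nat) ^ x" "2 \<le> (2::nat) ^ y"
    using assms(3,4) by (auto intro: self_le_power)
  then obtain p q where "(2::nat) ^ x = 2 + p" "(2::nat) ^ y = 2 + q"
    unfolding le_iff_add by blast
  then have "2 ^ x + 2 ^ y \<le> (2::nat) ^ x * 2 ^ y" by (simp add: algebra_simps)
  then show ?thesis using assms(1,2) by (simp add: power_add)
qed

lemma mult_less_power2:
  fixes a b x y :: nat
  assumes "a < 2 ^ x" "b < 2 ^ y"
  shows "a * b < 2 ^ (x + y)"
  using mult_strict_mono[OF assms] by (simp add: power_add)

lemma less_power2_mono: "a < 2 ^ x \<Longrightarrow> b \<le> a \<Longrightarrow> x \<le> y \<Longrightarrow> b < (2::nat) ^ y"
  by (meson le_less_trans less_le_trans one_le_numeral power_increasing)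

lemma aval_less:
  assumes "bounded B m"
  shows "aval e m < 2 ^ (B * expr_size e)"
proof (induction e)
  case (Const v)
  have "v < 2 ^ v" by (rule less_exp)
  moreover have "v \<le> B * Suc v" using assms by (cases B) (auto simp: bounded_def)
  ultimately show ?case using less_power2_mono[of v v v "B * Suc v"] by simp
next
  case (Fetch a e)
  then show ?case using assms by (simp add: bounded_def)
next
  case (Plus e1 e2)
  then show ?case
    using add_less_power2[OF Plus] assms expr_size_pos
    by (simp add: bounded_def distrib_left)
next
  case (Minus e1 e2)
  then show ?case using less_power2_mono[OF Minus(1)] by simp
next
  case (Times e1 e2)
  then show ?case using mult_less_power2[OF Times] by (simp add: distrib_left)
next
  case (Div e1 e2)
  then show ?case using less_power2_mono[OF Div(1)] by simp
qed

lemma bits_aval: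
  assumes "bounded B m"
  shows "bits (aval e m) \<le> B * expr_size e"
proof -
  have "0 < B * expr_size e" using assms expr_size_pos by (simp add: bounded_def)
  then show ?thesis
    using aval_less[OF assms] unfolding bits_def by (simp add: floorlog_le_iff Suc_le_eq)
qed

lemma acost_le:
  assumes "bounded B m"
  shows "acost e m \<le> B * expr_weight e"
proof (induction e)
  case (Const v)
  then show ?case using bits_aval[OF assms, of "Const v"] by simp
next
  case (Fetch a e)
  then show ?case
    using bits_aval[OF assms, of e] bits_aval[OF assms, of "Fetch a e"] by (simp add: distrib_left)
next
  case (Plus e1 e2)
  then show ?case
    using bits_aval[OF assms, of e1] bits_aval[OF assms, of e2] by (simp add: distrib_left)
next
  case (Minus e1 e2)
  then show ?case
    using bits_aval[OF assms, of e1] bits_aval[OF assms, of e2] by (simp add: distrib_left)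
next
  case (Times e1 e2)
  then show ?case
    using bits_aval[OF assms, of e1] bits_aval[OF assms, of e2] by (simp add: distrib_left)
next
  case (Div e1 e2)
  then show ?case
    using bits_aval[OF assms, of e1] bits_aval[OF assms, of e2] by (simp add: distrib_left)
qed

text \<open>As execution is deterministic, the existence of a halting run is total correctness.
  Boundedness of the final memory is included so that the next command can be charged with the same
  \<open>B\<close>.\<close>

definition runs :: "nat \<Rightarrow> com \<Rightarrow> memory \<Rightarrow> nat \<Rightarrow> (memory \<Rightarrow> bool) \<Rightarrow> bool" where
  "runs B c m T Q \<longleftrightarrow> (\<exists>t m'. exec c m t m' \<and> t \<le> B * T \<and> bounded B m' \<and> Q m')"

lemma runs_weaken:
  assumes "runs B c m T P" "T \<le> T'" "\<And>m'. bounded B m' \<Longrightarrow> P m' \<Longrightarrow> Q m'"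
  shows "runs B c m T' Q"
  using assms unfolding runs_def by (meson le_trans mult_le_mono2)

lemma runs_Skip:
  assumes "bounded B m" "Q m" "0 < T"
  shows "runs B Skip m T Q"
proof -
  have "1 \<le> B * T" using assms by (simp add: bounded_def Suc_le_eq)
  then show ?thesis using assms exec.Skip unfolding runs_def by blast
qed

text \<open>Intermediate values may exceed \<open>2 ^ B\<close>; only the stored value must not.
  Addresses are merely charged, so they carry no such condition.\<close>

lemma runs_Store:
  assumes "bounded B m" "aval e m < 2 ^ B"
    and "expr_weight i + expr_weight e + expr_size i + expr_size e \<le> T"
    and "Q (m(a := (m a)(aval i m := aval e m)))"
  shows "runs B (Store a i e) m T Q"
proof -
  have "acost i m + acost e m + bits (aval i m) + bits (aval e m)
      \<le> B * (expr_weight i + expr_weight e + expr_size i + expr_size e)"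
    using acost_le[OF assms(1)] bits_aval[OF assms(1)]
    unfolding distrib_left by (intro add_mono)
  also have "\<dots> \<le> B * T" using assms(3) by simp
  finally show ?thesis
    using assms exec.Store[of a i e m] unfolding runs_def by (fastforce simp: bounded_def)
qed

lemma runs_Seq:
  assumes "runs B c1 m T1 P" "\<And>m1. bounded B m1 \<Longrightarrow> P m1 \<Longrightarrow> runs B c2 m1 T2 Q"
    and "T1 + T2 \<le> T"
  shows "runs B (Seq c1 c2) m T Q"
proof -
  obtain t1 m1 where 1: "exec c1 m t1 m1" "t1 \<le> B * T1" "bounded B m1" "P m1"
    using assms(1) unfolding runs_def by blast
  obtain t2 m2 where 2: "exec c2 m1 t2 m2" "t2 \<le> B * T2" "bounded B m2" "Q m2"
    using assms(2)[OF 1(3,4)] unfolding runs_def by blast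
  have "t1 + t2 \<le> B * (T1 + T2)" using 1 2 by (simp add: distrib_left)
  also have "\<dots> \<le> B * T" using assms(3) by simp
  finally show ?thesis using exec.Seq[OF 1(1) 2(1)] 2 unfolding runs_def by blast
qed

lemma runs_Cond:
  assumes "bounded B m"
    and "aval e m \<noteq> 0 \<Longrightarrow> runs B c1 m T1 Q" "aval e m = 0 \<Longrightarrow> runs B c2 m T1 Q"
    and "expr_weight e + expr_size e + T1 \<le> T"
  shows "runs B (Cond e c1 c2) m T Q"
proof -
  have le: "acost e m + bits (aval e m) + t \<le> B * T" if "t \<le> B * T1" for t
  proof -
    have "acost e m + bits (aval e m) + t \<le> B * (expr_weight e + expr_size e + T1)"
      using acost_le[OF assms(1)] bits_aval[OF assms(1)] that
      unfolding distrib_left by (intro add_mono)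
    also have "\<dots> \<le> B * T" using assms(4) by simp
    finally show ?thesis .
  qed
  show ?thesis
  proof (cases "aval e m = 0")
    case True
    then show ?thesis
      using assms(3)[OF True] le exec.CondFalse[OF True] unfolding runs_def by blast
  next
    case False
    then show ?thesis
      using assms(2)[OF False] le exec.CondTrue[OF False] unfolding runs_def by blast
  qed
qed

section \<open>Registers and counting loops\<close>

abbreviation reg :: "nat \<Rightarrow> aexp" where
  "reg x \<equiv> Fetch x (Const 0)"

abbreviation assign :: "nat \<Rightarrow> aexp \<Rightarrow> com" where
  "assign x e \<equiv> Store x (Const 0) e"

text \<open>Subtraction truncates, so the guard vanishes once the counter reaches the value of
  \<open>e\<close>. Since \<open>e\<close> is evaluated anew before each round, the body must
  preserve its value.\<close>

definition for_loop :: "nat \<Rightarrow> aexp \<Rightarrow> com \<Rightarrow> com" where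
  "for_loop x e c = Seq (assign x (Const 0))
     (Loop (Minus e (reg x)) (Seq c (assign x (Plus (reg x) (Const 1)))))"

text \<open>The invariant \<open>I i\<close> is required after the counter has been set to \<open>i\<close>; in a loop body it must survive
  the assignment to the counter cell.\<close>

lemma runs_for_loop:
  assumes bd: "bounded B m" and b: "b < 2 ^ B"
    and init: "I 0 (m(x := (m x)(0 := 0)))"
    and bound: "\<And>i m. i \<le> b \<Longrightarrow> I i m \<Longrightarrow> aval e m = b"
    and weight: "expr_weight e + 2 * expr_size e \<le> 20"
    and step: "\<And>i m. i < b \<Longrightarrow> bounded B m \<Longrightarrow> m x 0 = i \<Longrightarrow> I i m \<Longrightarrow>
      runs B c m T (\<lambda>m'. m' x 0 = i \<and> I (Suc i) (m'(x := (m' x)(0 := Suc i))))"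
    and final: "\<And>m. bounded B m \<Longrightarrow> I b m \<Longrightarrow> Q m"
    and time: "b * (T + 40) + 50 \<le> T'"
  shows "runs B (for_loop x e c) m T' Q"
proof -
  let ?g = "Minus e (reg x)"
  let ?c = "Seq c (assign x (Plus (reg x) (Const 1)))"
  \<comment> \<open>The 25 is the 20 allowed for \<open>e\<close> plus 5 for \<open>reg x\<close>:
    its weight 3, and its size 1 counted twice.\<close>
  have guard: "acost ?g m + bits (aval ?g m) \<le> B * 25" if "bounded B m" for m
  proof -
    have "acost ?g m + bits (aval ?g m) \<le> B * expr_weight ?g + B * expr_size ?g"
      using acost_le[OF that, of ?g] bits_aval[OF that, of ?g] by (rule add_mono)
    also have "\<dots> = B * (expr_weight ?g + expr_size ?g)" by (simp only: distrib_left)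
    also have "\<dots> \<le> B * 25" using weight by (intro mult_le_mono2) simp
    finally show ?thesis .
  qed
  have loop: "runs B (Loop ?g ?c) m ((b - i) * (T + 40) + 25) (I b)"
    if "i \<le> b" "bounded B m" "m x 0 = i" "I i m" for i m
    using that
  proof (induction "b - i" arbitrary: i m)
    case 0
    then have "i = b" by simp
    then have "aval e m = b" using bound 0 by blast
    then have "aval ?g m = 0" using 0 \<open>i = b\<close> by simp
    from exec.LoopFalse[OF this] show ?case
      using 0 guard[OF 0(3)] unfolding runs_def
      by (intro exI[of _ "acost ?g m + bits (aval ?g m)"] exI[of _ m]) simp
  next
    case (Suc r)
    have i: "i < b" using Suc(2) by simp
    then have g: "aval ?g m \<noteq> 0" using bound[of i m] Suc by simp
    \<comment> \<open>Incrementing the counter needs 13 units; 15 together with the 25 of the guard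
      gives \<open>T + 40\<close> per round.\<close>
    have "runs B ?c m (T + 15) (\<lambda>m'. m' x 0 = Suc i \<and> I (Suc i) m')"
    proof (rule runs_Seq)
      show "runs B c m T (\<lambda>m'. m' x 0 = i \<and> I (Suc i) (m'(x := (m' x)(0 := Suc i))))"
        using step[OF i] Suc by simp
    qed (use i b in \<open>auto intro!: runs_Store\<close>)
    then obtain t1 m1 where 1: "exec ?c m t1 m1" "t1 \<le> B * (T + 15)" "bounded B m1"
        "m1 x 0 = Suc i" "I (Suc i) m1"
      unfolding runs_def by blast
    have "r = b - Suc i" "Suc i \<le> b" using Suc(2) by auto
    from Suc(1)[OF this 1(3-5)] obtain t2 m2
      where 2: "exec (Loop ?g ?c) m1 t2 m2" "t2 \<le> B * ((b - Suc i) * (T + 40) + 25)"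
        "bounded B m2" "I b m2"
      unfolding runs_def by blast
    have "acost ?g m + bits (aval ?g m) + t1 + t2
        \<le> B * 25 + B * (T + 15) + B * ((b - Suc i) * (T + 40) + 25)"
      using guard[OF Suc(4)] 1(2) 2(2) by (intro add_mono)
    also have "\<dots> = B * (Suc (b - Suc i) * (T + 40) + 25)" by (simp add: algebra_simps)
    also have "Suc (b - Suc i) = b - i" using i by simp
    finally show ?case
      using exec.LoopTrue[OF g 1(1) 2(1)] 2 unfolding runs_def by blast
  qed
  show ?thesis
    unfolding for_loop_def
  proof (rule runs_Seq)
    show "runs B (assign x (Const 0)) m 5 (\<lambda>m'. m' x 0 = 0 \<and> I 0 m')"
      using bd init by (intro runs_Store) auto
    show "runs B (Loop ?g ?c) m1 (b * (T + 40) + 25) Q"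
      if "bounded B m1" "m1 x 0 = 0 \<and> I 0 m1" for m1
      using loop[of 0 m1] that final by (auto elim!: runs_weaken)
  qed (use time in simp)
qed

text \<open>Cell \<open>0\<close> of an array serves as a register: \<open>0\<close> holds \<open>n\<close>, \<open>1\<close> the exponent, \<open>4\<close> the size of the
  root under construction (its successor table is array \<open>3\<close>), \<open>5\<close> the current cycle length, \<open>7\<close> and \<open>8\<close>
  the counts for the input and for the root, \<open>9\<close> the power of the latter, \<open>13\<close> the answer; \<open>6\<close>, \<open>10\<close>, \<open>12\<close>
  and \<open>14\<close> are loop counters and \<open>11\<close> follows an orbit.\<close>

definition differ :: "nat \<Rightarrow> nat \<Rightarrow> aexp" where
  "differ x y = Plus (Minus (reg x) (reg y)) (Minus (reg y) (reg x))"

section \<open>Subroutines for counts, powers and cycles\<close>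

definition count_fix :: "nat \<Rightarrow> nat \<Rightarrow> nat \<Rightarrow> com" where
  "count_fix tab sz out = Seq (assign out (Const 0))
     (for_loop 10 (reg sz)
       (Seq (assign 11 (reg 10))
         (Seq (for_loop 12 (reg 5) (assign 11 (Fetch tab (reg 11))))
           (Cond (differ 11 10) Skip (assign out (Plus (reg out) (Const 1)))))))"

lemma fix_count_lessThan_Suc:
  "fix_count {..<Suc i} f l = fix_count {..<i} f l + (if (f ^^ l) i = i then 1 else 0)"
proof -
  have "{u \<in> {..<Suc i}. (f ^^ l) u = u} =
      (if (f ^^ l) i = i then insert i {u \<in> {..<i}. (f ^^ l) u = u} else {u \<in> {..<i}. (f ^^ l) u = u})"
    by (auto simp: less_Suc_eq)
  then show ?thesis by (simp add: fix_count_def)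
qed

lemma fix_count_lessThan_le: "fix_count {..<i} f l \<le> i"
  using fix_count_le_card[of "{..<i}" f l] by simp

lemma runs_count_fix:
  assumes bd: "bounded B m" and sz: "m sz 0 = s" and l: "m 5 0 = l"
    and closed: "\<And>v. v < s \<Longrightarrow> m tab v < s"
    and regs: "tab \<notin> {10, 11, 12, out}" "sz \<notin> {10, 11, 12, out}" "out \<notin> {5, 10, 11, 12}"
  shows "runs B (count_fix tab sz out) m (s * (l * 80 + 300) + 100)
    (\<lambda>m'. m' out 0 = fix_count {..<s} (m tab) l \<and> (\<forall>a. a \<notin> {10, 11, 12, out} \<longrightarrow> m' a = m a))"
proof -
  let ?f = "m tab"
  let ?frame = "\<lambda>m'. \<forall>a. a \<notin> {10, 11, 12, out} \<longrightarrow> m' a = m a"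
  let ?I = "\<lambda>i m'. m' out 0 = fix_count {..<i} ?f l \<and> ?frame m'"
  have s_lt: "s < 2 ^ B" and l_lt: "l < 2 ^ B" using bd sz l by (auto simp: bounded_def)
  have fs: "?f ` {..<s} \<subseteq> {..<s}" using closed by auto
  have inner: "runs B (for_loop 12 (reg 5) (assign 11 (Fetch tab (reg 11)))) m1 (l * 80 + 50)
      (\<lambda>m'. m' 11 0 = (?f ^^ l) i \<and> m' 10 0 = i \<and> m' out 0 = fix_count {..<i} ?f l \<and> ?frame m')"
    if m1: "bounded B m1" "m1 11 0 = i" "m1 10 0 = i" "?I i m1" and i: "i < s" for m1 i
  proof (rule runs_for_loop[where b = l and T = 40 and
        I = "\<lambda>j m'. m' 11 0 = (?f ^^ j) i \<and> m' 10 0 = i \<and> ?I i m'"])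
    fix j m' assume m': "bounded B m'" "m' 11 0 = (?f ^^ j) i \<and> m' 10 0 = i \<and> ?I i m'" "m' 12 0 = j"
    \<comment> \<open>The walk stays among the \<open>s\<close> states, so the fetched value is
      below \<open>2 ^ B\<close>.\<close>
    have "(?f ^^ Suc j) i < s" using funpow_in[OF fs, of i "Suc j"] i by simp
    then have v: "?f ((?f ^^ j) i) < 2 ^ B" using s_lt by simp
    have tab: "m' tab = ?f" using m'(2) regs by simp
    show "runs B (assign 11 (Fetch tab (reg 11))) m' 40 (\<lambda>m'. m' 12 0 = j \<and>
        (m'(12 := (m' 12)(0 := Suc j))) 11 0 = (?f ^^ Suc j) i \<and>
        (m'(12 := (m' 12)(0 := Suc j))) 10 0 = i \<and> ?I i (m'(12 := (m' 12)(0 := Suc j))))"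
      using m' regs v tab by (intro runs_Store) auto
  qed (use m1 l_lt l regs in auto)
  show ?thesis
    unfolding count_fix_def
  proof (rule runs_Seq)
    show "runs B (assign out (Const 0)) m 5 (?I 0)"
      using bd regs by (intro runs_Store) (auto simp: fix_count_def)
    show "runs B (for_loop 10 (reg sz) (Seq (assign 11 (reg 10))
         (Seq (for_loop 12 (reg 5) (assign 11 (Fetch tab (reg 11))))
           (Cond (differ 11 10) Skip (assign out (Plus (reg out) (Const 1))))))) m0
        (s * (l * 80 + 300) + 90) (?I s)"
      if m0: "bounded B m0" "?I 0 m0" for m0
    proof (rule runs_for_loop[where b = s and T = "l * 80 + 200" and I = ?I])
      fix i m1 assume m1: "bounded B m1" "m1 10 0 = i" "?I i m1" and i: "i < s"
      show "runs B (Seq (assign 11 (reg 10))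
         (Seq (for_loop 12 (reg 5) (assign 11 (Fetch tab (reg 11))))
           (Cond (differ 11 10) Skip (assign out (Plus (reg out) (Const 1)))))) m1 (l * 80 + 200)
        (\<lambda>m'. m' 10 0 = i \<and> ?I (Suc i) (m'(10 := (m' 10)(0 := Suc i))))"
      proof (rule runs_Seq)
        show "runs B (assign 11 (reg 10)) m1 20
            (\<lambda>m'. m' 11 0 = i \<and> m' 10 0 = i \<and> ?I i m')"
          using m1 regs i s_lt by (intro runs_Store) auto
        show "runs B (Seq (for_loop 12 (reg 5) (assign 11 (Fetch tab (reg 11))))
           (Cond (differ 11 10) Skip (assign out (Plus (reg out) (Const 1))))) m2 (l * 80 + 150)
           (\<lambda>m'. m' 10 0 = i \<and> ?I (Suc i) (m'(10 := (m' 10)(0 := Suc i))))"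
          if m2: "bounded B m2" "m2 11 0 = i \<and> m2 10 0 = i \<and> ?I i m2" for m2
        proof (rule runs_Seq[OF inner[of m2 i]])
          fix m3 assume m3: "bounded B m3" "m3 11 0 = (?f ^^ l) i \<and> m3 10 0 = i \<and>
            m3 out 0 = fix_count {..<i} ?f l \<and> ?frame m3"
          \<comment> \<open>The counter gains at most 1 per visited state, so it never exceeds
            \<open>s\<close>.\<close>
          have out: "Suc (fix_count {..<i} ?f l) < 2 ^ B"
            using fix_count_lessThan_le[of i ?f l] i s_lt by simp
          show "runs B (Cond (differ 11 10) Skip (assign out (Plus (reg out) (Const 1)))) m3 100
           (\<lambda>m'. m' 10 0 = i \<and> ?I (Suc i) (m'(10 := (m' 10)(0 := Suc i))))"
          proof (rule runs_Cond[where ?T1.0 = 50])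
            assume "aval (differ 11 10) m3 \<noteq> 0"
            then show "runs B Skip m3 50
               (\<lambda>m'. m' 10 0 = i \<and> ?I (Suc i) (m'(10 := (m' 10)(0 := Suc i))))"
              using m3 regs by (intro runs_Skip) (auto simp: differ_def fix_count_lessThan_Suc)
          next
            assume "aval (differ 11 10) m3 = 0"
            then show "runs B (assign out (Plus (reg out) (Const 1))) m3 50
               (\<lambda>m'. m' 10 0 = i \<and> ?I (Suc i) (m'(10 := (m' 10)(0 := Suc i))))"
              using m3 regs out by (intro runs_Store) (auto simp: differ_def fix_count_lessThan_Suc)
          qed (use m3 in \<open>auto simp: differ_def\<close>)
        qed (use m2 i in auto)
      qed auto
    qed (use m0 s_lt sz regs in \<open>auto simp: algebra_simps\<close>)
  qed auto
qed

definition power_loop :: com where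
  "power_loop = Seq (assign 9 (Const 1)) (for_loop 12 (reg 1) (assign 9 (Times (reg 9) (reg 8))))"

text \<open>All intermediate powers are bounded, not only the last: for \<open>c = 0\<close> the
  initial value 1 can exceed the result.\<close>

lemma runs_power_loop:
  assumes bd: "bounded B m" and k: "m 1 0 = k" and c: "m 8 0 = c"
    and pow: "\<And>i. i \<le> k \<Longrightarrow> c ^ i < 2 ^ B"
  shows "runs B power_loop m (k * 80 + 100)
    (\<lambda>m'. m' 9 0 = c ^ k \<and> (\<forall>a. a \<notin> {9, 12} \<longrightarrow> m' a = m a))"
  unfolding power_loop_def
proof (rule runs_Seq)
  let ?I = "\<lambda>i m'. m' 9 0 = c ^ i \<and> (\<forall>a. a \<notin> {9, 12} \<longrightarrow> m' a = m a)"
  show "runs B (assign 9 (Const 1)) m 10 (?I 0)"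
    using bd pow[of 0] by (intro runs_Store) auto
  show "runs B (for_loop 12 (reg 1) (assign 9 (Times (reg 9) (reg 8)))) m1 (k * 80 + 90) (?I k)"
    if m1: "bounded B m1" "?I 0 m1" for m1
  proof (rule runs_for_loop[where b = k and T = 40 and I = ?I])
    fix i m2 assume i: "i < k" and m2: "bounded B m2" "m2 12 0 = i" "?I i m2"
    show "runs B (assign 9 (Times (reg 9) (reg 8))) m2 40
        (\<lambda>m'. m' 12 0 = i \<and> ?I (Suc i) (m'(12 := (m' 12)(0 := Suc i))))"
      using m2 c i pow[of "Suc i"] by (intro runs_Store) (auto simp: mult.commute)
  qed (use m1 k bd in \<open>auto simp: bounded_def\<close>)
qed auto

text \<open>The two tables are fixed as whole functions, so framing an array preserves them at once;
  of the registers only cell 0 matters.\<close>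

definition instance_memory ::
    "nat \<Rightarrow> nat \<Rightarrow> (nat \<Rightarrow> nat) \<Rightarrow> nat \<Rightarrow> (nat \<Rightarrow> nat) \<Rightarrow> memory \<Rightarrow> bool" where
  "instance_memory n k f s g m \<longleftrightarrow>
     m 0 0 = n \<and> m 1 0 = k \<and> m 2 = f \<and> m 3 = g \<and> m 4 0 = s"

definition compare_counts :: com where
  "compare_counts = Seq (count_fix 2 0 7) (Seq (count_fix 3 4 8) power_loop)"

lemma runs_compare_counts:
  assumes bd: "bounded B m" and inst: "instance_memory n k f s g m" and l: "m 5 0 = l"
    and f: "\<And>v. v < n \<Longrightarrow> f v < n" and g: "\<And>v. v < s \<Longrightarrow> g v < s"
    and pow: "\<And>i. i \<le> k \<Longrightarrow> fix_count {..<s} g l ^ i < 2 ^ B"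
  shows "runs B compare_counts m ((n + s) * (l * 80 + 300) + k * 80 + 300)
    (\<lambda>m'. m' 7 0 = fix_count {..<n} f l \<and> m' 9 0 = fix_count {..<s} g l ^ k \<and>
      (\<forall>a. a \<notin> {7, 8, 9, 10, 11, 12} \<longrightarrow> m' a = m a))"
  unfolding compare_counts_def
proof (rule runs_Seq)
  show "runs B (count_fix 2 0 7) m (n * (l * 80 + 300) + 100)
    (\<lambda>m'. m' 7 0 = fix_count {..<n} (m 2) l \<and> (\<forall>a. a \<notin> {10, 11, 12, 7} \<longrightarrow> m' a = m a))"
    using bd inst l f by (intro runs_count_fix) (auto simp: instance_memory_def)
next
  fix m1 assume m1: "bounded B m1"
    "m1 7 0 = fix_count {..<n} (m 2) l \<and> (\<forall>a. a \<notin> {10, 11, 12, 7} \<longrightarrow> m1 a = m a)"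
  show "runs B (Seq (count_fix 3 4 8) power_loop) m1 (s * (l * 80 + 300) + k * 80 + 200)
    (\<lambda>m'. m' 7 0 = fix_count {..<n} f l \<and> m' 9 0 = fix_count {..<s} g l ^ k \<and>
      (\<forall>a. a \<notin> {7, 8, 9, 10, 11, 12} \<longrightarrow> m' a = m a))"
  proof (rule runs_Seq)
    show "runs B (count_fix 3 4 8) m1 (s * (l * 80 + 300) + 100)
      (\<lambda>m'. m' 8 0 = fix_count {..<s} (m1 3) l \<and> (\<forall>a. a \<notin> {10, 11, 12, 8} \<longrightarrow> m' a = m1 a))"
      using m1 inst l g by (intro runs_count_fix) (auto simp: instance_memory_def)
  next
    fix m2 assume m2: "bounded B m2"
      "m2 8 0 = fix_count {..<s} (m1 3) l \<and> (\<forall>a. a \<notin> {10, 11, 12, 8} \<longrightarrow> m2 a = m1 a)"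
    show "runs B power_loop m2 (k * 80 + 100)
      (\<lambda>m'. m' 7 0 = fix_count {..<n} f l \<and> m' 9 0 = fix_count {..<s} g l ^ k \<and>
        (\<forall>a. a \<notin> {7, 8, 9, 10, 11, 12} \<longrightarrow> m' a = m a))"
      by (rule runs_weaken[OF runs_power_loop[of B m2 k "fix_count {..<s} g l"]])
        (use m1 m2 inst pow in \<open>auto simp: instance_memory_def\<close>)
  qed auto
qed (auto simp: algebra_simps)

definition append_cycle :: "nat \<Rightarrow> nat \<Rightarrow> (nat \<Rightarrow> nat) \<Rightarrow> nat \<Rightarrow> nat" where
  "append_cycle s l g v = (if s \<le> v \<and> v < s + l then s + Suc (v - s) mod l else g v)"

text \<open>The loop writes plain successors for all new states, and one store then redirects the
  last of them to the first; this replaces the reduction modulo \<open>l\<close>. The size changes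
  last because the addresses are relative to the old one.\<close>

definition add_cycle :: com where
  "add_cycle = Seq
     (for_loop 12 (reg 5)
       (Store 3 (Plus (reg 4) (reg 12)) (Plus (Plus (reg 4) (reg 12)) (Const 1))))
     (Seq (Store 3 (Minus (Plus (reg 4) (reg 5)) (Const 1)) (reg 4))
       (assign 4 (Plus (reg 4) (reg 5))))"

lemma runs_add_cycle:
  assumes bd: "bounded B m" and g: "m 3 = g" and s: "m 4 0 = s" and l: "m 5 0 = l" "0 < l"
    and lt: "s + l < 2 ^ B"
  shows "runs B add_cycle m (l * 80 + 150)
    (\<lambda>m'. m' 3 = append_cycle s l g \<and> m' 4 0 = s + l \<and> (\<forall>a. a \<notin> {3, 4, 12} \<longrightarrow> m' a = m a))"
  unfolding add_cycle_def
proof (rule runs_Seq)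
  let ?I = "\<lambda>i m'. m' 3 = (\<lambda>v. if s \<le> v \<and> v < s + i then Suc v else g v) \<and>
    (\<forall>a. a \<notin> {3, 12} \<longrightarrow> m' a = m a)"
  show "runs B (for_loop 12 (reg 5)
       (Store 3 (Plus (reg 4) (reg 12)) (Plus (Plus (reg 4) (reg 12)) (Const 1)))) m (l * 80 + 50) (?I l)"
  proof (rule runs_for_loop[where b = l and T = 40 and I = ?I])
    fix i m2 assume i: "i < l" and m2: "bounded B m2" "m2 12 0 = i" "?I i m2"
    show "runs B (Store 3 (Plus (reg 4) (reg 12)) (Plus (Plus (reg 4) (reg 12)) (Const 1))) m2 40
        (\<lambda>m'. m' 12 0 = i \<and> ?I (Suc i) (m'(12 := (m' 12)(0 := Suc i))))"
      using m2 s i lt by (intro runs_Store) auto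
  qed (use bd g l lt in auto)
  show "runs B (Seq (Store 3 (Minus (Plus (reg 4) (reg 5)) (Const 1)) (reg 4))
       (assign 4 (Plus (reg 4) (reg 5)))) m1 100
    (\<lambda>m'. m' 3 = append_cycle s l g \<and> m' 4 0 = s + l \<and> (\<forall>a. a \<notin> {3, 4, 12} \<longrightarrow> m' a = m a))"
    if m1: "bounded B m1" "?I l m1" for m1
  proof (rule runs_Seq)
    have "append_cycle s l g = (\<lambda>v. if s \<le> v \<and> v < s + l then Suc v else g v)(s + l - 1 := s)"
    proof
      fix v
      \<comment> \<open>Within the new block, \<open>Suc (v - s) = l\<close> singles out the last
        state, the only one where \<open>mod\<close> wraps around.\<close>
      show "append_cycle s l g v = ((\<lambda>v. if s \<le> v \<and> v < s + l then Suc v else g v)(s + l - 1 := s)) v"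
        using l(2) by (cases "Suc (v - s) = l") (auto simp: append_cycle_def)
    qed
    then show "runs B (Store 3 (Minus (Plus (reg 4) (reg 5)) (Const 1)) (reg 4)) m1 50
        (\<lambda>m'. m' 3 = append_cycle s l g \<and> (\<forall>a. a \<notin> {3, 12} \<longrightarrow> m' a = m a))"
      using m1 s l lt by (intro runs_Store) auto
    show "runs B (assign 4 (Plus (reg 4) (reg 5))) m2 50
      (\<lambda>m'. m' 3 = append_cycle s l g \<and> m' 4 0 = s + l \<and> (\<forall>a. a \<notin> {3, 4, 12} \<longrightarrow> m' a = m a))"
      if "bounded B m2" "m2 3 = append_cycle s l g \<and> (\<forall>a. a \<notin> {3, 12} \<longrightarrow> m2 a = m a)" for m2
      using that s l lt by (intro runs_Store) auto
  qed simp
qed simp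

subsection \<open>Greedy construction of the root\<close>

lemma cycle_enum_append_cycle:
  assumes "0 < l"
  shows "cycle_enum (\<lambda>i. s + i) l {s..<s + l} (append_cycle s l g)"
proof -
  have "bij_betw (\<lambda>i. s + i) {..<l} {s..<s + l}"
    by (rule bij_betw_byWitness[where f' = "\<lambda>v. v - s"]) auto
  then show ?thesis using assms by (auto simp: cycle_enum_def append_cycle_def)
qed

lemma bij_betw_append_cycle:
  assumes g: "bij_betw g {..<s} {..<s}" and l: "0 < l"
  shows "bij_betw (append_cycle s l g) {..<s + l} {..<s + l}"
proof -
  have "bij_betw (append_cycle s l g) {..<s} {..<s}"
    using g by (rule bij_betw_cong[THEN iffD1, rotated]) (simp add: append_cycle_def)
  then have "bij_betw (append_cycle s l g) ({..<s} \<union> {s..<s + l}) ({..<s} \<union> {s..<s + l})"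
    using cycle_enum_bij[OF cycle_enum_append_cycle[OF l]] by (rule bij_betw_combine) auto
  moreover have "{..<s} \<union> {s..<s + l} = {..<s + l}" by auto
  ultimately show ?thesis by simp
qed

lemma fix_count_append_cycle:
  assumes g: "bij_betw g {..<s} {..<s}" and l: "0 < l"
  shows "fix_count {..<s + l} (append_cycle s l g) d =
    fix_count {..<s} g d + (if l dvd d then l else 0)"
proof -
  have split: "{..<s + l} = {..<s} \<union> {s..<s + l}" by auto
  have "fix_count {..<s} (append_cycle s l g) d = fix_count {..<s} g d"
    using g by (intro fix_count_cong) (auto simp: bij_betw_def append_cycle_def)
  moreover have "fix_count {s..<s + l} (append_cycle s l g) d = (if l dvd d then l else 0)"
    using cycle_enum_append_cycle[OF l] by (rule fix_count_cycle)
  ultimately show ?thesis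
    unfolding split by (subst fix_count_Un_disjoint) auto
qed

text \<open>For permutations this says that the \<open>k\<close>-th power of \<open>h\<close> on
  \<open>V\<close> is isomorphic to \<open>f\<close> on \<open>{..<n}\<close>, by
  \<open>power_isomorphic_iff_fix_count\<close>.\<close>

definition root_counts :: "nat \<Rightarrow> nat \<Rightarrow> (nat \<Rightarrow> nat) \<Rightarrow> nat set \<Rightarrow> (nat \<Rightarrow> nat) \<Rightarrow> bool" where
  "root_counts n k f V h \<longleftrightarrow> (\<forall>d\<le>n. fix_count V h d ^ k = fix_count {..<n} f d)"

text \<open>The greedy construction never commits to a wrong choice: every solution \<open>V\<close> contains the partial
  root \<open>g\<close> up to a complement \<open>W\<close> without cycles of length at most \<open>x\<close>.  The bound \<open>n - j\<close> makes \<open>n\<close> rounds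
  suffice to exhaust the cycles of length \<open>Suc x\<close>.\<close>

definition partial_root ::
    "nat \<Rightarrow> nat \<Rightarrow> (nat \<Rightarrow> nat) \<Rightarrow> nat \<Rightarrow> nat \<Rightarrow> nat \<Rightarrow> (nat \<Rightarrow> nat) \<Rightarrow> bool" where
  "partial_root n k f x j s g \<longleftrightarrow>
     bij_betw g {..<s} {..<s} \<and> s \<le> (x * n + j) * n \<and>
     (\<forall>V h. finite V \<and> bij_betw h V V \<and> root_counts n k f V h \<longrightarrow>
        (\<exists>W\<subseteq>V. bij_betw h W W \<and>
           (\<forall>d. fix_count V h d = fix_count {..<s} g d + fix_count W h d) \<and>
           (\<forall>d. 0 < d \<and> d \<le> x \<longrightarrow> fix_count W h d = 0) \<and>
           fix_count W h (Suc x) \<le> n - j))"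

lemma partial_rootD:
  assumes "partial_root n k f x j s g"
  shows "bij_betw g {..<s} {..<s}" "s \<le> (x * n + j) * n"
  using assms unfolding partial_root_def by blast+

lemma partial_root_complement:
  assumes "partial_root n k f x j s g" "finite V" "bij_betw h V V" "root_counts n k f V h"
  obtains W where "W \<subseteq> V" "finite W" "bij_betw h W W"
    "\<And>d. fix_count V h d = fix_count {..<s} g d + fix_count W h d"
    "\<And>d. 0 < d \<Longrightarrow> d \<le> x \<Longrightarrow> fix_count W h d = 0" "fix_count W h (Suc x) \<le> n - j"
proof -
  have "\<exists>W\<subseteq>V. bij_betw h W W \<and>
      (\<forall>d. fix_count V h d = fix_count {..<s} g d + fix_count W h d) \<and>
      (\<forall>d. 0 < d \<and> d \<le> x \<longrightarrow> fix_count W h d = 0) \<and> fix_count W h (Suc x) \<le> n - j"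
    using assms unfolding partial_root_def by simp
  then show thesis using that finite_subset[OF _ assms(2)] by metis
qed

text \<open>The equation for \<open>d = 0\<close> reads \<open>card V ^ k = n\<close>.\<close>

lemma root_counts_card:
  assumes "0 < k" "root_counts n k f V h"
  shows "card V \<le> n"
proof -
  have "card V ^ k = n" using assms by (auto simp: root_counts_def dest: spec[of _ 0])
  then show ?thesis using self_le_power[of "card V" k] assms(1) by (cases "card V = 0") auto
qed

text \<open>The complement is all of \<open>V\<close>, whose counts are at most
  \<open>card V\<close> and hence at most \<open>n\<close>.\<close>

lemma partial_root_start:
  assumes "0 < k"
  shows "partial_root n k f 0 0 0 g"
proof -
  have le: "fix_count V h (Suc 0) \<le> n" if "finite V" "root_counts n k f V h" for V h
    using fix_count_le_card[OF that(1)] root_counts_card[OF assms that(2)] le_trans by blast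
  show ?thesis
    unfolding partial_root_def
  proof (intro conjI allI impI)
    fix V h assume "finite V \<and> bij_betw h V V \<and> root_counts n k f V h"
    then show "\<exists>W\<subseteq>V. bij_betw h W W \<and>
        (\<forall>d. fix_count V h d = fix_count {..<0} g d + fix_count W h d) \<and>
        (\<forall>d. 0 < d \<and> d \<le> 0 \<longrightarrow> fix_count W h d = 0) \<and> fix_count W h (Suc 0) \<le> n - 0"
      using le by (intro exI[of _ V]) (simp add: fix_count_def[of "{}"])
  qed (simp_all add: bij_betw_def)
qed

text \<open>After \<open>n\<close> rounds the bound is \<open>n - n\<close>, so no cycle of length
  \<open>Suc x\<close> is left in the complement. For the next length the bound starts again at
  \<open>n\<close>, which \<open>card V\<close> never exceeds.\<close>

lemma partial_root_next:
  assumes "0 < k" "partial_root n k f x n s g"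
  shows "partial_root n k f (Suc x) 0 s g"
  unfolding partial_root_def
proof (intro conjI allI impI)
  fix V h assume V: "finite V \<and> bij_betw h V V \<and> root_counts n k f V h"
  obtain W where W: "W \<subseteq> V" "bij_betw h W W"
      "\<And>d. fix_count V h d = fix_count {..<s} g d + fix_count W h d"
      "\<And>d. 0 < d \<Longrightarrow> d \<le> x \<Longrightarrow> fix_count W h d = 0" "fix_count W h (Suc x) \<le> n - n"
    using partial_root_complement[OF assms(2)] V by metis
  have "fix_count W h (Suc (Suc x)) \<le> card V"
    using fix_count_mono[of V W h "Suc (Suc x)"] fix_count_le_card[of V h "Suc (Suc x)"] W V by linarith
  then have "fix_count W h (Suc (Suc x)) \<le> n - 0"
    using root_counts_card[OF assms(1)] V by fastforce
  moreover have "fix_count W h d = 0" if "0 < d \<and> d \<le> Suc x" for d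
    using W(4)[of d] W(5) that by (cases "d = Suc x") auto
  ultimately show "\<exists>W\<subseteq>V. bij_betw h W W \<and>
      (\<forall>d. fix_count V h d = fix_count {..<s} g d + fix_count W h d) \<and>
      (\<forall>d. 0 < d \<and> d \<le> Suc x \<longrightarrow> fix_count W h d = 0) \<and> fix_count W h (Suc (Suc x)) \<le> n - 0"
    using W by (intro exI[of _ W]) simp
qed (use partial_rootD[OF assms(2)] in \<open>simp_all add: add.commute\<close>)

text \<open>Comparing \<open>k\<close>-th powers shows that \<open>V\<close> has no more points
  fixed by the iterate \<open>Suc x\<close> than \<open>g\<close>, so the complement has none and
  any bound holds.\<close>

lemma partial_root_skip:
  assumes k: "0 < k" and part: "partial_root n k f x j s g" and x: "x < n"
    and le: "fix_count {..<n} f (Suc x) \<le> fix_count {..<s} g (Suc x) ^ k"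
  shows "partial_root n k f x (Suc j) s g"
  unfolding partial_root_def
proof (intro conjI allI impI)
  fix V h assume V: "finite V \<and> bij_betw h V V \<and> root_counts n k f V h"
  obtain W where W: "W \<subseteq> V" "bij_betw h W W"
      "\<And>d. fix_count V h d = fix_count {..<s} g d + fix_count W h d"
      "\<And>d. 0 < d \<Longrightarrow> d \<le> x \<Longrightarrow> fix_count W h d = 0"
    using partial_root_complement[OF part] V by metis
  have "fix_count V h (Suc x) ^ k \<le> fix_count {..<s} g (Suc x) ^ k"
    using V le x by (simp add: root_counts_def)
  then have "fix_count V h (Suc x) \<le> fix_count {..<s} g (Suc x)"
    using k by simp
  then have "fix_count W h (Suc x) \<le> n - Suc j" using W(3) by simp
  then show "\<exists>W\<subseteq>V. bij_betw h W W \<and>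
      (\<forall>d. fix_count V h d = fix_count {..<s} g d + fix_count W h d) \<and>
      (\<forall>d. 0 < d \<and> d \<le> x \<longrightarrow> fix_count W h d = 0) \<and> fix_count W h (Suc x) \<le> n - Suc j"
    using W by (intro exI[of _ W]) simp
qed (use partial_rootD[OF part] in simp_all)

text \<open>The strict inequality forces a point of the complement to be fixed by
  \<open>h ^^ Suc x\<close>. As nothing shorter is left there, it lies on a cycle of length exactly
  \<open>Suc x\<close>, which moves from the complement to the root.\<close>

lemma partial_root_append:
  assumes part: "partial_root n k f x j s g" and x: "x < n"
    and less: "fix_count {..<s} g (Suc x) ^ k < fix_count {..<n} f (Suc x)"
  shows "partial_root n k f x (Suc j) (s + Suc x) (append_cycle s (Suc x) g)"
  unfolding partial_root_def
proof (intro conjI allI impI)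
  let ?l = "Suc x"
  have g: "bij_betw g {..<s} {..<s}" by (rule partial_rootD(1)[OF part])
  then show "bij_betw (append_cycle s ?l g) {..<s + ?l} {..<s + ?l}"
    by (rule bij_betw_append_cycle) simp
  \<comment> \<open>Each round adds at most \<open>n\<close> states, because \<open>Suc x\<close> is
    at most \<open>n\<close>.\<close>
  show "s + ?l \<le> (x * n + Suc j) * n"
    using partial_rootD(2)[OF part] x by simp
  fix V h assume V: "finite V \<and> bij_betw h V V \<and> root_counts n k f V h"
  obtain W where W: "W \<subseteq> V" "bij_betw h W W"
      "\<And>d. fix_count V h d = fix_count {..<s} g d + fix_count W h d"
      "\<And>d. 0 < d \<Longrightarrow> d \<le> x \<Longrightarrow> fix_count W h d = 0" "fix_count W h ?l \<le> n - j"
    and fin: "finite W"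
    using partial_root_complement[OF part] V by metis
  have "fix_count V h ?l ^ k = fix_count {..<n} f ?l" using V x by (simp add: root_counts_def)
  then have "fix_count V h ?l \<noteq> fix_count {..<s} g ?l" using less by auto
  then have "0 < fix_count W h ?l" using W(3)[of ?l] by simp
  then obtain A c where A: "A \<subseteq> W" "bij_betw h (W - A) (W - A)"
      "\<And>d. fix_count W h d = (if ?l dvd d then ?l else 0) + fix_count (W - A) h d"
    using ex_shortest_cycle[OF fin W(2), of ?l] W(4) by (metis less_Suc_eq_le zero_less_Suc)
  have "fix_count V h d = fix_count {..<s + ?l} (append_cycle s ?l g) d + fix_count (W - A) h d" for d
    using W(3)[of d] A(3)[of d] fix_count_append_cycle[OF g, of ?l d] by simp
  moreover have "fix_count (W - A) h d = 0" if "0 < d \<and> d \<le> x" for d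
    using W(4)[of d] A(3)[of d] that by simp
  \<comment> \<open>The count drops by \<open>Suc x\<close>, and a drop of 1 is enough.\<close>
  moreover have "fix_count (W - A) h ?l \<le> n - Suc j"
    using W(5) A(3)[of ?l] by simp
  ultimately show "\<exists>W\<subseteq>V. bij_betw h W W \<and>
      (\<forall>d. fix_count V h d = fix_count {..<s + ?l} (append_cycle s ?l g) d + fix_count W h d) \<and>
      (\<forall>d. 0 < d \<and> d \<le> x \<longrightarrow> fix_count W h d = 0) \<and> fix_count W h ?l \<le> n - Suc j"
    using W(1) A(2) by (intro exI[of _ "W - A"] conjI) auto
qed

text \<open>The complement has at most \<open>n\<close> states and no cycle of length at most
  \<open>n\<close>, hence is empty. So if any root exists, the greedy result is one.\<close>

lemma partial_root_complete:
  assumes k: "0 < k" and part: "partial_root n k f n 0 s g"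
    and V: "finite V" "bij_betw h V V" "root_counts n k f V h"
  shows "root_counts n k f {..<s} g"
proof -
  obtain W where W: "W \<subseteq> V" "bij_betw h W W"
      "\<And>d. fix_count V h d = fix_count {..<s} g d + fix_count W h d"
      "\<And>d. 0 < d \<Longrightarrow> d \<le> n \<Longrightarrow> fix_count W h d = 0"
    and fin: "finite W"
    using partial_root_complement[OF part V] by metis
  have "card W \<le> n"
    using card_mono[OF V(1) W(1)] root_counts_card[OF k V(3)] by simp
  then have "W = {}"
    using ex_period_le_card[OF fin W(2)] W(4) by (metis le_trans less_numeral_extra(3))
  then have "fix_count V h d = fix_count {..<s} g d" for d
    using W(3)[of d] by (simp add: fix_count_def)
  then show ?thesis using V(3) by (simp add: root_counts_def)
qed

subsection \<open>The algorithm\<close>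

text \<open>The bound of \<open>runs_compare_counts\<close> at the extreme values: root size
  \<open>n * n * n\<close>, cycle length \<open>n\<close>, exponent \<open>Suc n\<close>.\<close>

definition compare_time :: "nat \<Rightarrow> nat" where
  "compare_time n = (n + n * n * n) * (n * 80 + 300) + Suc n * 80 + 300"

definition build_root :: com where
  "build_root = for_loop 14 (reg 0)
     (Seq (assign 5 (Plus (reg 14) (Const 1)))
       (for_loop 6 (reg 0)
         (Seq compare_counts (Cond (Minus (reg 7) (reg 9)) add_cycle Skip))))"

definition build_time :: "nat \<Rightarrow> nat" where
  "build_time n = n * (n * (compare_time n + n * 80 + 300) + 200) + 100"

lemma runs_compare_counts_bounded:
  assumes bd: "bounded B m" and inst: "instance_memory n k f s g m" and l: "m 5 0 = l" "l \<le> n"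
    and f: "bij_betw f {..<n} {..<n}" and g: "bij_betw g {..<s} {..<s}"
    and s: "s \<le> n * n * n" and k: "k \<le> Suc n"
    and pow: "\<And>c i. c \<le> n * n * n \<Longrightarrow> i \<le> k \<Longrightarrow> c ^ i < 2 ^ B"
  shows "runs B compare_counts m (compare_time n)
    (\<lambda>m'. m' 7 0 = fix_count {..<n} f l \<and> m' 9 0 = fix_count {..<s} g l ^ k \<and>
      (\<forall>a. a \<notin> {7, 8, 9, 10, 11, 12} \<longrightarrow> m' a = m a))"
proof (rule runs_weaken[OF runs_compare_counts[OF bd inst l(1)]])
  show "f v < n" if "v < n" for v using f that by (auto dest: bij_betwE)
  show "g v < s" if "v < s" for v using g that by (auto dest: bij_betwE)
  show "fix_count {..<s} g l ^ i < 2 ^ B" if "i \<le> k" for i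
    using pow[OF _ that] fix_count_lessThan_le[of s g l] s by simp
  show "(n + s) * (l * 80 + 300) + k * 80 + 300 \<le> compare_time n"
    unfolding compare_time_def using s l k by (intro add_mono mult_mono) auto
qed

lemma runs_build_root:
  assumes bd: "bounded B m" and inst: "instance_memory n k f 0 g m"
    and f: "bij_betw f {..<n} {..<n}" and k: "0 < k" "k \<le> Suc n"
    and pow: "\<And>c i. c \<le> n * n * n \<Longrightarrow> i \<le> k \<Longrightarrow> c ^ i < 2 ^ B" and n: "Suc n < 2 ^ B"
  shows "runs B build_root m (build_time n)
    (\<lambda>m'. \<exists>s g. instance_memory n k f s g m' \<and> partial_root n k f n 0 s g)"
  unfolding build_root_def
proof (rule runs_for_loop[where b = n and T = "n * (compare_time n + n * 80 + 300) + 100" and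
      I = "\<lambda>x m'. \<exists>s g. instance_memory n k f s g m' \<and> partial_root n k f x 0 s g"])
  let ?P = "\<lambda>x j m'. \<exists>s g. instance_memory n k f s g m' \<and> partial_root n k f x j s g"
  let ?J = "\<lambda>x j m'. m' 14 0 = x \<and> m' 5 0 = Suc x \<and> ?P x j m'"
  fix x m1 assume x: "x < n" and m1: "bounded B m1" "m1 14 0 = x" "?P x 0 m1"
  show "runs B (Seq (assign 5 (Plus (reg 14) (Const 1)))
       (for_loop 6 (reg 0)
         (Seq compare_counts (Cond (Minus (reg 7) (reg 9)) add_cycle Skip)))) m1
      (n * (compare_time n + n * 80 + 300) + 100)
      (\<lambda>m'. m' 14 0 = x \<and> ?P (Suc x) 0 (m'(14 := (m' 14)(0 := Suc x))))"
  proof (rule runs_Seq)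
    show "runs B (assign 5 (Plus (reg 14) (Const 1))) m1 50 (?J x 0)"
      using m1 x n by (intro runs_Store) (auto simp: instance_memory_def)
    fix m2 assume m2: "bounded B m2" "?J x 0 m2"
    show "runs B (for_loop 6 (reg 0)
         (Seq compare_counts (Cond (Minus (reg 7) (reg 9)) add_cycle Skip))) m2
      (n * (compare_time n + n * 80 + 300) + 50)
      (\<lambda>m'. m' 14 0 = x \<and> ?P (Suc x) 0 (m'(14 := (m' 14)(0 := Suc x))))"
    proof (rule runs_for_loop[where b = n and T = "compare_time n + n * 80 + 250" and I = "?J x"])
      fix j m3 assume j: "j < n" and m3: "bounded B m3" "m3 6 0 = j" "?J x j m3"
      then obtain s g where sg: "instance_memory n k f s g m3" "partial_root n k f x j s g" by blast
      have g: "bij_betw g {..<s} {..<s}" and s: "s \<le> (x * n + j) * n"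
        using partial_rootD[OF sg(2)] by auto
      \<comment> \<open>At most \<open>n * n\<close> rounds are over after this one, so even the
        enlarged root has at most \<open>n * n * n\<close> states and its size is below
        \<open>2 ^ B\<close>.\<close>
      have "x * n + Suc j \<le> Suc x * n" using j by simp
      also have "\<dots> \<le> n * n" using x by (intro mult_right_mono) auto
      finally have "(x * n + Suc j) * n \<le> n * n * n" by (rule mult_right_mono) simp
      moreover have "(x * n + Suc j) * n = (x * n + j) * n + n" by (simp add: algebra_simps)
      ultimately have s_le: "s + Suc x \<le> n * n * n" using s x by linarith
      then have s_lt: "s + Suc x < 2 ^ B" using pow[of "s + Suc x" 1] k by simp
      show "runs B (Seq compare_counts (Cond (Minus (reg 7) (reg 9)) add_cycle Skip)) m3
        (compare_time n + n * 80 + 250)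
        (\<lambda>m'. m' 6 0 = j \<and> ?J x (Suc j) (m'(6 := (m' 6)(0 := Suc j))))"
      proof (rule runs_Seq[OF runs_compare_counts_bounded[OF m3(1) sg(1) _ _ f g]])
        fix m4 assume m4: "bounded B m4" "m4 7 0 = fix_count {..<n} f (Suc x) \<and>
          m4 9 0 = fix_count {..<s} g (Suc x) ^ k \<and>
          (\<forall>a. a \<notin> {7, 8, 9, 10, 11, 12} \<longrightarrow> m4 a = m3 a)"
        show "runs B (Cond (Minus (reg 7) (reg 9)) add_cycle Skip) m4 (n * 80 + 200)
          (\<lambda>m'. m' 6 0 = j \<and> ?J x (Suc j) (m'(6 := (m' 6)(0 := Suc j))))"
        proof (rule runs_Cond[OF m4(1), where ?T1.0 = "n * 80 + 150"])
          assume "aval (Minus (reg 7) (reg 9)) m4 \<noteq> 0"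
          then have part: "partial_root n k f x (Suc j) (s + Suc x) (append_cycle s (Suc x) g)"
            using m4 by (intro partial_root_append[OF sg(2) x]) simp
          have "runs B add_cycle m4 (Suc x * 80 + 150) (\<lambda>m'. m' 3 = append_cycle s (Suc x) g \<and>
            m' 4 0 = s + Suc x \<and> (\<forall>a. a \<notin> {3, 4, 12} \<longrightarrow> m' a = m4 a))"
            using m4 m3 sg(1) s_lt by (intro runs_add_cycle) (auto simp: instance_memory_def)
          then show "runs B add_cycle m4 (n * 80 + 150)
            (\<lambda>m'. m' 6 0 = j \<and> ?J x (Suc j) (m'(6 := (m' 6)(0 := Suc j))))"
          proof (rule runs_weaken)
            fix m' assume "m' 3 = append_cycle s (Suc x) g \<and>
              m' 4 0 = s + Suc x \<and> (\<forall>a. a \<notin> {3, 4, 12} \<longrightarrow> m' a = m4 a)"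
            moreover from this have
              "instance_memory n k f (s + Suc x) (append_cycle s (Suc x) g) (m'(6 := (m' 6)(0 := Suc j)))"
              using m4 sg(1) by (simp add: instance_memory_def)
            ultimately show "m' 6 0 = j \<and> ?J x (Suc j) (m'(6 := (m' 6)(0 := Suc j)))"
              using part m4 m3 by auto
          qed (use x in simp)
        next
          assume "aval (Minus (reg 7) (reg 9)) m4 = 0"
          then have "partial_root n k f x (Suc j) s g"
            using m4 by (intro partial_root_skip[OF k(1) sg(2) x]) simp
          moreover have "instance_memory n k f s g (m4(6 := (m4 6)(0 := Suc j)))"
            using m4 sg(1) by (simp add: instance_memory_def)
          ultimately show "runs B Skip m4 (n * 80 + 150)
            (\<lambda>m'. m' 6 0 = j \<and> ?J x (Suc j) (m'(6 := (m' 6)(0 := Suc j))))"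
            using m4 m3 by (intro runs_Skip) auto
        qed simp
      qed (use m3 x s_le k pow in auto)
    next
      fix m3 assume "?J x n m3"
      then obtain s g where sg: "m3 14 0 = x" "instance_memory n k f s g m3" "partial_root n k f x n s g"
        by blast
      then have "instance_memory n k f s g (m3(14 := (m3 14)(0 := Suc x)))"
        by (simp add: instance_memory_def)
      then show "m3 14 0 = x \<and> ?P (Suc x) 0 (m3(14 := (m3 14)(0 := Suc x)))"
        using sg(1) partial_root_next[OF k(1) sg(3)] by blast
    qed (use m2 n in \<open>auto simp: instance_memory_def algebra_simps\<close>)
  qed simp
next
  have "instance_memory n k f 0 g (m(14 := (m 14)(0 := 0)))"
    using inst by (simp add: instance_memory_def)
  then show "\<exists>s g. instance_memory n k f s g (m(14 := (m 14)(0 := 0))) \<and> partial_root n k f 0 0 s g"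
    using partial_root_start[OF k(1)] by blast
  show "n * (n * (compare_time n + n * 80 + 300) + 100 + 40) + 50 \<le> build_time n"
    unfolding build_time_def by (rule add_mono[OF mult_le_mono2]) simp_all
qed (use bd n in \<open>auto simp: instance_memory_def\<close>)

text \<open>Soundness of a positive answer rests on this check. The limit \<open>n + 1\<close> lets
  the counter run from 0, where sizes are compared, to \<open>n\<close>.\<close>

definition verify_root :: com where
  "verify_root = Seq (assign 13 (Const 1))
     (for_loop 14 (Plus (reg 0) (Const 1))
       (Seq (assign 5 (reg 14))
         (Seq compare_counts (Cond (differ 7 9) (assign 13 (Const 0)) Skip))))"

definition verify_time :: "nat \<Rightarrow> nat" where
  "verify_time n = Suc n * (compare_time n + 300) + 100"

lemma runs_verify_root:
  assumes bd: "bounded B m" and inst: "instance_memory n k f s g m"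
    and f: "bij_betw f {..<n} {..<n}" and g: "bij_betw g {..<s} {..<s}"
    and s: "s \<le> n * n * n" and k: "k \<le> Suc n"
    and pow: "\<And>c i. c \<le> n * n * n \<Longrightarrow> i \<le> k \<Longrightarrow> c ^ i < 2 ^ B" and n: "Suc n < 2 ^ B"
  shows "runs B verify_root m (verify_time n)
    (\<lambda>m'. instance_memory n k f s g m' \<and> m' 13 0 = (if root_counts n k f {..<s} g then 1 else 0))"
  unfolding verify_root_def
proof (rule runs_Seq)
  let ?eq = "\<lambda>d. fix_count {..<s} g d ^ k = fix_count {..<n} f d"
  let ?I = "\<lambda>i m'. instance_memory n k f s g m' \<and> m' 13 0 = (if \<forall>d<i. ?eq d then 1 else 0)"
  have one: "1 < (2::nat) ^ B" using bd by (simp add: bounded_def one_less_power del: One_nat_def)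
  show "runs B (assign 13 (Const 1)) m 50 (?I 0)"
    using bd inst one by (intro runs_Store) (auto simp: instance_memory_def)
  fix m1 assume m1: "bounded B m1" "?I 0 m1"
  show "runs B (for_loop 14 (Plus (reg 0) (Const 1))
       (Seq (assign 5 (reg 14))
         (Seq compare_counts (Cond (differ 7 9) (assign 13 (Const 0)) Skip)))) m1
      (Suc n * (compare_time n + 300) + 50)
    (\<lambda>m'. instance_memory n k f s g m' \<and> m' 13 0 = (if root_counts n k f {..<s} g then 1 else 0))"
  proof (rule runs_for_loop[where b = "Suc n" and T = "compare_time n + 200" and I = ?I])
    fix i m2 assume i: "i < Suc n" and m2: "bounded B m2" "m2 14 0 = i" "?I i m2"
    show "runs B (Seq (assign 5 (reg 14))
         (Seq compare_counts (Cond (differ 7 9) (assign 13 (Const 0)) Skip))) m2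
      (compare_time n + 200) (\<lambda>m'. m' 14 0 = i \<and> ?I (Suc i) (m'(14 := (m' 14)(0 := Suc i))))"
    proof (rule runs_Seq)
      show "runs B (assign 5 (reg 14)) m2 50 (\<lambda>m'. m' 5 0 = i \<and> m' 14 0 = i \<and> ?I i m')"
        using m2 i n by (intro runs_Store) (auto simp: instance_memory_def)
      fix m3 assume m3: "bounded B m3" "m3 5 0 = i \<and> m3 14 0 = i \<and> ?I i m3"
      show "runs B (Seq compare_counts (Cond (differ 7 9) (assign 13 (Const 0)) Skip)) m3
        (compare_time n + 150) (\<lambda>m'. m' 14 0 = i \<and> ?I (Suc i) (m'(14 := (m' 14)(0 := Suc i))))"
      proof (rule runs_Seq[OF runs_compare_counts_bounded[where l = i and n = n and k = k and f = f and s = s and g = g]])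
        fix m4 assume m4: "bounded B m4" "m4 7 0 = fix_count {..<n} f i \<and>
          m4 9 0 = fix_count {..<s} g i ^ k \<and>
          (\<forall>a. a \<notin> {7, 8, 9, 10, 11, 12} \<longrightarrow> m4 a = m3 a)"
        have inst4: "instance_memory n k f s g m4" using m3 m4 by (simp add: instance_memory_def)
        show "runs B (Cond (differ 7 9) (assign 13 (Const 0)) Skip) m4 100
          (\<lambda>m'. m' 14 0 = i \<and> ?I (Suc i) (m'(14 := (m' 14)(0 := Suc i))))"
        proof (rule runs_Cond[OF m4(1), where ?T1.0 = 50])
          assume "aval (differ 7 9) m4 \<noteq> 0"
          then have "\<not> ?eq i" using m4 by (auto simp: differ_def)
          then show "runs B (assign 13 (Const 0)) m4 50
            (\<lambda>m'. m' 14 0 = i \<and> ?I (Suc i) (m'(14 := (m' 14)(0 := Suc i))))"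
            using m4 m3 inst4 by (intro runs_Store) (auto simp: instance_memory_def)
        next
          assume "aval (differ 7 9) m4 = 0"
          then have "?eq i" using m4 by (auto simp: differ_def)
          then have "(\<forall>d<Suc i. ?eq d) \<longleftrightarrow> (\<forall>d<i. ?eq d)" by (auto simp: less_Suc_eq)
          then show "runs B Skip m4 50
            (\<lambda>m'. m' 14 0 = i \<and> ?I (Suc i) (m'(14 := (m' 14)(0 := Suc i))))"
            using m4 m3 inst4 by (intro runs_Skip) (simp_all add: instance_memory_def)
        qed (simp add: differ_def)
      qed (use m3 i f g s k pow in auto)
    qed simp
  next
    show "instance_memory n k f s g m' \<and> m' 13 0 = (if root_counts n k f {..<s} g then 1 else 0)"
      if "?I (Suc n) m'" for m'
      using that by (auto simp: root_counts_def less_Suc_eq_le)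
  qed (use m1 n in \<open>auto simp: instance_memory_def algebra_simps\<close>)
qed (simp add: verify_time_def)

text \<open>Output and input share their arrays, so nothing is written before the check is over.
  Entries of the old table beyond the new size may survive; the output digraph does not read
  them.\<close>

definition write_output :: com where
  "write_output = Seq (for_loop 12 (reg 4) (Store 2 (reg 12) (Fetch 3 (reg 12))))
     (Seq (assign 1 (reg 4)) (assign 0 (reg 13)))"

lemma runs_write_output:
  assumes bd: "bounded B m" and g: "m 3 = g" and s: "m 4 0 = s" and r: "m 13 0 = r"
  shows "runs B write_output m (s * 90 + 150)
    (\<lambda>m'. m' 0 0 = r \<and> m' 1 0 = s \<and> (\<forall>v<s. m' 2 v = g v))"
  unfolding write_output_def
proof (rule runs_Seq)
  let ?I = "\<lambda>i m'. m' 3 = g \<and> m' 4 0 = s \<and> m' 13 0 = r \<and> (\<forall>v<i. m' 2 v = g v)"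
  have lt: "s < 2 ^ B" "r < 2 ^ B" "\<And>v. g v < 2 ^ B" using assms by (auto simp: bounded_def)
  show "runs B (for_loop 12 (reg 4) (Store 2 (reg 12) (Fetch 3 (reg 12)))) m (s * 90 + 50) (?I s)"
  proof (rule runs_for_loop[where b = s and T = 50 and I = ?I])
    fix i m1 assume "i < s" "bounded B m1" "m1 12 0 = i" "?I i m1"
    then show "runs B (Store 2 (reg 12) (Fetch 3 (reg 12))) m1 50
        (\<lambda>m'. m' 12 0 = i \<and> ?I (Suc i) (m'(12 := (m' 12)(0 := Suc i))))"
      using lt by (intro runs_Store) (auto simp: less_Suc_eq)
  qed (use assms lt in auto)
  fix m1 assume m1: "bounded B m1" "?I s m1"
  show "runs B (Seq (assign 1 (reg 4)) (assign 0 (reg 13))) m1 100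
    (\<lambda>m'. m' 0 0 = r \<and> m' 1 0 = s \<and> (\<forall>v<s. m' 2 v = g v))"
  proof (rule runs_Seq)
    show "runs B (assign 1 (reg 4)) m1 50
      (\<lambda>m'. m' 1 0 = s \<and> m' 13 0 = r \<and> (\<forall>v<s. m' 2 v = g v))"
      using m1 lt by (intro runs_Store) auto
    show "runs B (assign 0 (reg 13)) m2 50
      (\<lambda>m'. m' 0 0 = r \<and> m' 1 0 = s \<and> (\<forall>v<s. m' 2 v = g v))"
      if "bounded B m2" "m2 1 0 = s \<and> m2 13 0 = r \<and> (\<forall>v<s. m2 2 v = g v)" for m2
      using that lt by (intro runs_Store) auto
  qed simp
qed simp

definition cap_exponent :: com where
  "cap_exponent = Cond (Minus (reg 1) (Plus (reg 0) (Const 1)))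
     (assign 1 (Plus (reg 0) (Const 1))) Skip"

lemma runs_cap_exponent:
  assumes bd: "bounded B m" and inst: "instance_memory n k f s g m" and n: "Suc n < 2 ^ B"
  shows "runs B cap_exponent m 100 (instance_memory n (min k (Suc n)) f s g)"
  unfolding cap_exponent_def
proof (rule runs_Cond[where ?T1.0 = 50])
  assume "aval (Minus (reg 1) (Plus (reg 0) (Const 1))) m \<noteq> 0"
  then show "runs B (assign 1 (Plus (reg 0) (Const 1))) m 50 (instance_memory n (min k (Suc n)) f s g)"
    using bd inst n by (intro runs_Store) (auto simp: instance_memory_def)
next
  assume "aval (Minus (reg 1) (Plus (reg 0) (Const 1))) m = 0"
  then show "runs B Skip m 50 (instance_memory n (min k (Suc n)) f s g)"
    using bd inst by (intro runs_Skip) (auto simp: instance_memory_def)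
qed (use bd in auto)

definition root_algorithm :: com where
  "root_algorithm = Seq cap_exponent (Seq build_root (Seq verify_root write_output))"

definition root_time :: "nat \<Rightarrow> nat" where
  "root_time n = build_time n + verify_time n + n * n * n * 90 + 250"

lemma runs_root_algorithm:
  assumes bd: "bounded B m" and inst: "instance_memory n k f 0 g m"
    and f: "bij_betw f {..<n} {..<n}" and k: "0 < k"
    and pow: "\<And>c i. c \<le> n * n * n \<Longrightarrow> i \<le> Suc n \<Longrightarrow> c ^ i < 2 ^ B" and n: "Suc n < 2 ^ B"
  shows "runs B root_algorithm m (root_time n)
    (\<lambda>m'. \<exists>s g. partial_root n (min k (Suc n)) f n 0 s g \<and> m' 1 0 = s \<and> (\<forall>v<s. m' 2 v = g v) \<and>
      m' 0 0 = (if root_counts n (min k (Suc n)) f {..<s} g then 1 else 0))"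
  unfolding root_algorithm_def
proof (rule runs_Seq[OF runs_cap_exponent[OF bd inst n]])
  let ?k = "min k (Suc n)"
  let ?Q = "\<lambda>m'. \<exists>s g. partial_root n (min k (Suc n)) f n 0 s g \<and> m' 1 0 = s \<and> (\<forall>v<s. m' 2 v = g v) \<and>
      m' 0 0 = (if root_counts n (min k (Suc n)) f {..<s} g then 1 else 0)"
  have k': "0 < ?k" "?k \<le> Suc n" using k by auto
  have pow': "c ^ i < 2 ^ B" if "c \<le> n * n * n" "i \<le> ?k" for c i using pow that by simp
  fix m1 assume m1: "bounded B m1" "instance_memory n ?k f 0 g m1"
  show "runs B (Seq build_root (Seq verify_root write_output)) m1
      (build_time n + (verify_time n + (n * n * n * 90 + 150))) ?Q"
  proof (rule runs_Seq[OF runs_build_root[OF m1 f k' pow' n]])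
    fix m2 assume m2: "bounded B m2" "\<exists>s g. instance_memory n ?k f s g m2 \<and> partial_root n ?k f n 0 s g"
    then obtain s g where sg: "instance_memory n ?k f s g m2" "partial_root n ?k f n 0 s g" by blast
    have g: "bij_betw g {..<s} {..<s}" and s: "s \<le> n * n * n"
      using partial_rootD[OF sg(2)] by auto
    show "runs B (Seq verify_root write_output) m2 (verify_time n + (n * n * n * 90 + 150)) ?Q"
    proof (rule runs_Seq[OF runs_verify_root[OF m2(1) sg(1) f g s k'(2) pow' n]])
      fix m3 assume m3: "bounded B m3" "instance_memory n ?k f s g m3 \<and>
        m3 13 0 = (if root_counts n ?k f {..<s} g then 1 else 0)"
      have "runs B write_output m3 (s * 90 + 150)
        (\<lambda>m'. m' 0 0 = m3 13 0 \<and> m' 1 0 = s \<and> (\<forall>v<s. m' 2 v = g v))"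
        using m3 by (intro runs_write_output) (auto simp: instance_memory_def)
      then show "runs B write_output m3 (n * n * n * 90 + 150) ?Q"
        by (rule runs_weaken) (use s sg m3 in auto)
    qed auto
  qed auto
qed (simp add: root_time_def)

subsection \<open>Polynomial bounds\<close>

text \<open>For \<open>z\<close> at least 1, powers increase with the exponent, so adding exponents
  works for sums as well as for products.\<close>

definition poly_bounded :: "(nat \<Rightarrow> nat) \<Rightarrow> bool" where
  "poly_bounded p \<longleftrightarrow> (\<exists>C d. \<forall>z\<ge>1. p z \<le> C * z ^ d)"

lemma poly_bounded_const: "poly_bounded (\<lambda>z. c)"
  unfolding poly_bounded_def by (intro exI[of _ c] exI[of _ 0]) simp

lemma poly_bounded_id: "poly_bounded (\<lambda>z. z)"
  unfolding poly_bounded_def by (intro exI[of _ 1]) simp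

lemma poly_bounded_add:
  assumes "poly_bounded p" "poly_bounded q"
  shows "poly_bounded (\<lambda>z. p z + q z)"
proof -
  obtain C d C' d' where b: "\<And>z. z \<ge> 1 \<Longrightarrow> p z \<le> C * z ^ d" "\<And>z. z \<ge> 1 \<Longrightarrow> q z \<le> C' * z ^ d'"
    using assms unfolding poly_bounded_def by metis
  have "p z + q z \<le> (C + C') * z ^ (d + d')" if z: "z \<ge> 1" for z
  proof -
    have "C * z ^ d \<le> C * z ^ (d + d')" "C' * z ^ d' \<le> C' * z ^ (d + d')"
      using z by (auto intro!: mult_le_mono2 power_increasing)
    then show ?thesis unfolding distrib_right using b[OF z] by linarith
  qed
  then show ?thesis unfolding poly_bounded_def by blast
qed

lemma poly_bounded_mult:
  assumes "poly_bounded p" "poly_bounded q"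
  shows "poly_bounded (\<lambda>z. p z * q z)"
proof -
  obtain C d C' d' where b: "\<And>z. z \<ge> 1 \<Longrightarrow> p z \<le> C * z ^ d" "\<And>z. z \<ge> 1 \<Longrightarrow> q z \<le> C' * z ^ d'"
    using assms unfolding poly_bounded_def by metis
  have "p z * q z \<le> (C * C') * z ^ (d + d')" if z: "z \<ge> 1" for z
    using mult_le_mono[OF b(1)[OF z] b(2)[OF z]] by (simp add: power_add mult_ac)
  then show ?thesis unfolding poly_bounded_def by blast
qed

text \<open>A base of at most \<open>n * n * n\<close> is at most \<open>2 ^ (3 * Suc n)\<close>,
  and exponents are at most \<open>Suc n\<close>, whence the product. The summand \<open>b\<close>
  makes room for the exponent before it is capped, and 1 makes the inequality strict.\<close>

definition width :: "nat \<Rightarrow> nat \<Rightarrow> nat" where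
  "width n b = 3 * Suc n * Suc n + b + 1"

lemma cubic_power_less_width:
  assumes "c \<le> n * n * n" "i \<le> Suc n"
  shows "c ^ i < 2 ^ width n b"
proof -
  have n: "n \<le> 2 ^ n" using less_exp[of n] by simp
  have "n * n * n \<le> 2 ^ n * 2 ^ n * 2 ^ n" using n by (intro mult_le_mono)
  also have "\<dots> = 2 ^ (3 * n)" by (simp flip: power_add add: numeral_3_eq_3)
  also have "\<dots> \<le> 2 ^ (3 * Suc n)" by (rule power_increasing) auto
  finally have "c \<le> 2 ^ (3 * Suc n)" using assms(1) by simp
  then have "c ^ i \<le> (2 ^ (3 * Suc n)) ^ i" by (rule power_mono) simp
  also have "\<dots> = 2 ^ (3 * Suc n * i)" by (rule power_mult[symmetric])
  also have "\<dots> < 2 ^ width n b"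
  proof (rule power_strict_increasing)
    have "3 * Suc n * i \<le> 3 * Suc n * Suc n" using assms(2) by (rule mult_le_mono2)
    then show "3 * Suc n * i < width n b" by (simp add: width_def)
  qed simp
  finally show ?thesis .
qed

lemma Suc_less_width: "Suc n < 2 ^ width n b"
proof -
  have "Suc n < 2 ^ Suc n" by (rule less_exp)
  also have "(2::nat) ^ Suc n \<le> 2 ^ width n b" by (rule power_increasing) (auto simp: width_def)
  finally show ?thesis .
qed

section \<open>Correctness and running time of the whole program\<close>

lemma bounded_input_memory:
  assumes "\<And>v. v < n \<Longrightarrow> f v < n"
  shows "bounded (width n (floorlog 2 k)) (input_memory n f k)"
proof -
  let ?B = "width n (floorlog 2 k)"
  have n: "n < 2 ^ ?B" using Suc_less_width[of n] Suc_lessD by blast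
  have k: "k < 2 ^ ?B"
  proof (cases "k = 0")
    case False
    then have "k < 2 ^ floorlog 2 k" using floorlog_bounds[of k 2] by simp
    also have "(2::nat) ^ floorlog 2 k \<le> 2 ^ ?B" by (rule power_increasing) (auto simp: width_def)
    finally show ?thesis .
  qed simp
  have "f v < 2 ^ ?B" if "v < n" for v using assms[OF that] n by simp
  then show ?thesis using n k by (auto simp: bounded_def input_memory_def width_def)
qed

lemma root_counts_capped_iff:
  assumes "0 < k"
  shows "root_counts n (min k (Suc n)) f V h \<longleftrightarrow> root_counts n k f V h"
  unfolding root_counts_def
  using power_eq_iff_capped[OF assms fix_count_lessThan_le] by simp

lemma root_algorithm_correct:
  assumes perm: "perm_digraph (table_digraph n f)" and k: "0 < k"
  shows "\<exists>t m. exec root_algorithm (input_memory n f k) t m \<and>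
    t \<le> width n (floorlog 2 k) * root_time n \<and>
    (if \<exists>X :: nat pair_pre_digraph.
          perm_digraph X \<and> isomorphic (digraph_power X k) (table_digraph n f)
     then output_answer m = 1 \<and> perm_digraph (output_digraph m) \<and>
       isomorphic (digraph_power (output_digraph m) k) (table_digraph n f)
     else output_answer m = 0)"
proof -
  \<comment> \<open>The input array is 0 from \<open>n\<close> on, whereas \<open>f\<close> is
    arbitrary there; \<open>?F\<close> is the function actually stored.\<close>
  let ?B = "width n (floorlog 2 k)" and ?F = "\<lambda>i. if i < n then f i else 0"
  have f: "bij_betw f {..<n} {..<n}"
    using perm by (simp add: table_digraph_eq perm_fun_digraph_iff)
  then have F: "bij_betw ?F {..<n} {..<n}"
    by (rule bij_betw_cong[THEN iffD1, rotated]) simp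
  have fF: "fix_count {..<n} ?F d = fix_count {..<n} f d" for d
    using f by (intro fix_count_cong) (auto simp: bij_betw_def)
  have iso_iff: "isomorphic (digraph_power (fun_digraph V h) k) (table_digraph n f) \<longleftrightarrow>
      root_counts n (min k (Suc n)) ?F V h" if "finite V" "bij_betw h V V" for V :: "nat set" and h
    using power_isomorphic_iff_fix_count[OF that _ f, of k]
    by (simp add: table_digraph_eq root_counts_capped_iff[OF k]) (simp add: root_counts_def fF)
  have "runs ?B root_algorithm (input_memory n f k) (root_time n)
    (\<lambda>m'. \<exists>s g. partial_root n (min k (Suc n)) ?F n 0 s g \<and> m' 1 0 = s \<and> (\<forall>v<s. m' 2 v = g v) \<and>
      m' 0 0 = (if root_counts n (min k (Suc n)) ?F {..<s} g then 1 else 0))"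
  proof (rule runs_root_algorithm[where g = "\<lambda>_. 0"])
    show "bounded ?B (input_memory n f k)"
      using f by (intro bounded_input_memory) (auto dest: bij_betwE)
    show "instance_memory n k ?F 0 (\<lambda>_. 0) (input_memory n f k)"
      by (auto simp: instance_memory_def input_memory_def)
  qed (use F k cubic_power_less_width Suc_less_width in auto)
  then obtain t m s g where run: "exec root_algorithm (input_memory n f k) t m" "t \<le> ?B * root_time n"
    and part: "partial_root n (min k (Suc n)) ?F n 0 s g"
    and out: "m 1 0 = s" "\<And>v. v < s \<Longrightarrow> m 2 v = g v"
    and answer: "m 0 0 = (if root_counts n (min k (Suc n)) ?F {..<s} g then 1 else 0)"
    unfolding runs_def by blast
  have g: "bij_betw g {..<s} {..<s}" by (rule partial_rootD(1)[OF part])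
  then have m2: "bij_betw (m 2) {..<s} {..<s}"
    by (rule bij_betw_cong[THEN iffD1, rotated]) (simp add: out)
  have "fix_count {..<s} (m 2) d = fix_count {..<s} g d" for d
    using g by (intro fix_count_cong) (auto simp: bij_betw_def out)
  then have out_iso: "isomorphic (digraph_power (output_digraph m) k) (table_digraph n f) \<longleftrightarrow>
      root_counts n (min k (Suc n)) ?F {..<s} g"
    using iso_iff[OF _ m2] by (simp add: output_digraph_def table_digraph_eq out(1)[simplified] root_counts_def)
  have out_perm: "perm_digraph (output_digraph m)"
    using m2 by (simp add: output_digraph_def table_digraph_eq out(1)[simplified] perm_fun_digraph_iff)
  have complete: "root_counts n (min k (Suc n)) ?F {..<s} g"
    if X: "perm_digraph X" "isomorphic (digraph_power X k) (table_digraph n f)"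
    for X :: "nat pair_pre_digraph"
  proof -
    obtain V h where V: "finite V" "bij_betw h V V" "X = fun_digraph V h"
      using X(1) by (auto simp: perm_digraph_iff)
    then have "root_counts n (min k (Suc n)) ?F V h" using X(2) iso_iff by blast
    then show ?thesis using partial_root_complete[OF _ part V(1,2)] k by simp
  qed
  \<comment> \<open>The output itself is a witness in one direction; \<open>complete\<close> gives
    the other.\<close>
  have ex_iff: "(\<exists>X :: nat pair_pre_digraph.
        perm_digraph X \<and> isomorphic (digraph_power X k) (table_digraph n f)) \<longleftrightarrow>
      root_counts n (min k (Suc n)) ?F {..<s} g"
    using out_iso out_perm complete by blast
  show ?thesis
  proof (intro exI conjI)
    show "if \<exists>X :: nat pair_pre_digraph.
          perm_digraph X \<and> isomorphic (digraph_power X k) (table_digraph n f)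
     then output_answer m = 1 \<and> perm_digraph (output_digraph m) \<and>
       isomorphic (digraph_power (output_digraph m) k) (table_digraph n f)
     else output_answer m = 0"
      unfolding ex_iff using out_iso out_perm answer by (simp add: output_answer_def)
  qed (fact run)+
qed

theorem theorem3:
  shows "\<exists>(alg :: com) (C :: nat) (d :: nat).
    \<forall>(n :: nat) (f :: nat \<Rightarrow> nat) (k :: nat).
      perm_digraph (table_digraph n f) \<and> k > 0 \<longrightarrow>
      (\<exists>t m. exec alg (input_memory n f k) t m \<and>
         t \<le> C * (n + floorlog 2 k) ^ d \<and>
         (if \<exists>X :: nat pair_pre_digraph.
               perm_digraph X \<and> isomorphic (digraph_power X k) (table_digraph n f)
          then output_answer m = 1 \<and>
               perm_digraph (output_digraph m) \<and>
               isomorphic (digraph_power (output_digraph m) k) (table_digraph n f)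
          else output_answer m = 0))"
proof -
  \<comment> \<open>Width and time are monotone, so both arguments may be raised to the single
    variable \<open>z = n + floorlog 2 k\<close>.\<close>
  have "poly_bounded (\<lambda>z. width z z * root_time z)"
    unfolding width_def root_time_def build_time_def verify_time_def compare_time_def
      Suc_eq_plus1
    by (intro poly_bounded_add poly_bounded_mult poly_bounded_const poly_bounded_id)
  then obtain C d where Cd: "\<And>z. z \<ge> 1 \<Longrightarrow> width z z * root_time z \<le> C * z ^ d"
    unfolding poly_bounded_def by metis
  have time: "width n (floorlog 2 k) * root_time n \<le> C * (n + floorlog 2 k) ^ d" if "0 < k" for n k
  proof -
    let ?z = "n + floorlog 2 k"
    have "width n (floorlog 2 k) * root_time n \<le> width ?z ?z * root_time ?z"
      unfolding width_def root_time_def build_time_def verify_time_def compare_time_def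
      by (intro add_mono mult_mono) auto
    \<comment> \<open>A positive \<open>k\<close> has at least one binary digit, so
      \<open>?z\<close> is at least 1 even for \<open>n = 0\<close>.\<close>
    also have "\<dots> \<le> C * ?z ^ d" using that by (intro Cd) (simp add: floorlog_def)
    finally show ?thesis .
  qed
  show ?thesis
    using root_algorithm_correct time
    by (intro exI[of _ root_algorithm] exI[of _ C] exI[of _ d]) (meson order_trans)
qed

end
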